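(* Let $\mathbf b=(b_1,\dots,b_n)$ and $\mathbf b'=(b'_1,\dots,b'_n)$ be two elements of the integer lattice $\mathbb Z^n$, and let $\psi_{\mathbf b},\psi_{\mathbf b'}$ be the respective circle actions on the symplectic manifold $M_\Delta$, diffeomorphic to $\mathbb P(L_1\oplus\cdots\oplus L_{n-1}\oplus\mathbb C)$. If $\mathbf b\equiv\mathbf b'$, then $\psi_{\mathbf b}\sim\psi_{\mathbf b'}$.
   Context: Let $a_1,\dots,a_{n-1}\in\mathbb Z$ and let $\sigma>0,\tau>0$ be reals with $\tau+a_i\sigma>0$ for all $i$. Let $e_1,\dots,e_n$ be the standard basis of $\mathbb R^n$ and put $v_j=-e_j$ for $j=1,\dots,n$, $v_{n+1}=\sum_{j=1}^{n-1}e_j$, $v_{n+2}=e_n-\sum_{i=1}^{n-1}a_ie_i$, $k_j=0$ for $j\le n$, $k_{n+1}=\sigma$, $k_{n+2}=\tau$. Then $\Delta=\bigcap_{i=1}^{n+2}\{x\in(\mathbb R^n)^*:\langle x,v_i\rangle\le k_i\}$ is a Delzant polytope, and the associated symplectic toric manifold is the symplectic quotient $$M_\Delta=\Big\{(z_i)\in\mathbb C^{n+2}:\ \sum_{j\in\{1,\dots,n-1,n+1\}}|z_j|^2=\sigma/\pi,\ -\sum_{j=1}^{n-1}a_j|z_j|^2+|z_n|^2+|z_{n+2}|^2=\tau/\pi\Big\}\Big/\simeq,$$ where $(z'_j)\simeq(z_j)$ iff there are $\epsilon,\lambda\in U(1)$ with $z'_j=\lambda\epsilon^{-a_j}z_j$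 for $j=1,\dots,n-1$, $z'_k=\epsilon z_k$ for $k=n,n+2$, and $z'_{n+1}=\lambda z_{n+1}$. The symplectic form is the reduced one, so that the $U(1)^n$-action $(\lambda_j)\cdot[z]=[\lambda_1z_1,\dots,\lambda_nz_n,z_{n+1},z_{n+2}]$ has moment map $\mu([z])=\pi(|z_1|^2,\dots,|z_n|^2)$ with image $\Delta$. $M_\Delta$ is the total space of the bundle $\mathbb P(L_1\oplus\cdots\oplus L_{n-1}\oplus\mathbb C)\to\mathbb CP^1$, where $L_i$ is the holomorphic line bundle over $\mathbb CP^1$ with first Chern number $-a_i$. For $\mathbf b\in\mathbb Z^n$, $\psi_{\mathbf b}$ is the circle action $\psi_{\mathbf b}(t)[z]=[e^{2\pi ib_1t}z_1,\dots,e^{2\pi ib_nt}z_n,z_{n+1},z_{n+2}]$. $\mathbf b\equiv\mathbf b'$ means: either $\mathbf b=\mathbf b'$, or $b'_j=b_j+a_jb_n$ for $j=1,\dots,n-1$ and $b'_n=-b_n$. $\mathrm{Ham}(M)$ is the group of Hamiltonian diffeomorphisms with its usual ($C^\infty$) topology; $\varphi\sim\varphi'$, for Lie group homomorphisms $\varphi,\varphi':U(1)\to\mathrm{Ham}(M)$, means that there is a continuous family $\{\varphi^s:U(1)\to\mathrm{Ham}(M)\}_{s\in[0,1]}$ of Lie group homomorphisms with $\varphi^0=\varphi$ and $\varphi^1=\varphi'$. *)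

theory Defs
  imports "HOL-Analysis.Analysis"
begin

section \<open>Smooth functions\<close>

fun iter_deriv ::
  "'a::real_normed_vector list \<Rightarrow> ('a \<Rightarrow> 'b::real_normed_vector) \<Rightarrow> 'a \<Rightarrow> 'b" where
  "iter_deriv [] f = f"
| "iter_deriv (v # vs) f = iter_deriv vs (\<lambda>x. frechet_derivative f (at x) v)"

text \<open>For open \<open>S\<close> this is the usual notion; for other sets (the cylinder \<open>{0..1} \<times> W\<close>, the unit
  circle, a level set) a smooth function is one that extends locally to a smooth function on an
  open subset of the ambient space.\<close>

definition smooth_on ::
  "'a::real_normed_vector set \<Rightarrow> ('a \<Rightarrow> 'b::real_normed_vector) \<Rightarrow> bool" where
  "smooth_on S f \<longleftrightarrow>
     (\<forall>x\<in>S. \<exists>W F. open W \<and> x \<in> W \<and>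
        (\<forall>vs. \<forall>y\<in>W. iter_deriv vs F differentiable (at y)) \<and>
        (\<forall>y\<in>W \<inter> S. F y = f y))"

abbreviation U1 :: "complex set" where
  "U1 \<equiv> sphere 0 1"

section \<open>Symplectic manifolds given by charts, and Hamiltonian diffeomorphisms\<close>

type_synonym ('p, 'e) chart = "'p set \<times> ('p \<Rightarrow> 'e)"

text \<open>\<open>sform (U, c) x\<close> is the coordinate expression of the symplectic form at the point of \<open>U\<close>
  with coordinates \<open>x\<close>. Self-maps of the manifold are represented by functions that are
  extensional on \<open>pts\<close>, so that equal maps are equal functions.\<close>

record ('p, 'e) smanifold =
  pts :: "'p set"
  atlas :: "('p, 'e) chart set"
  sform :: "('p, 'e) chart \<Rightarrow> 'e \<Rightarrow> 'e \<Rightarrow> 'e \<Rightarrow> real"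

text \<open>Smoothness of \<open>(t, p) \<mapsto> f t p\<close> on \<open>T \<times> pts M\<close>, for a set \<open>T\<close> of parameters.\<close>

definition smooth_family ::
  "('p, 'e::euclidean_space) smanifold \<Rightarrow> 't::real_normed_vector set \<Rightarrow> ('t \<Rightarrow> 'p \<Rightarrow> 'p) \<Rightarrow> bool"
  where
  "smooth_family M T f \<longleftrightarrow>
     (\<forall>(U, c)\<in>atlas M. \<forall>(V, d)\<in>atlas M.
        let S = {(t, x). t \<in> T \<and> x \<in> c ` U \<and> f t (inv_into U c x) \<in> V}
        in openin (top_of_set (T \<times> c ` U)) S \<and>
           smooth_on S (\<lambda>(t, x). d (f t (inv_into U c x))))"

definition smooth_fun_family ::
  "('p, 'e::euclidean_space) smanifold \<Rightarrow> 't::real_normed_vector set \<Rightarrow> ('t \<Rightarrow> 'p \<Rightarrow> real) \<Rightarrow> bool"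
  where
  "smooth_fun_family M T H \<longleftrightarrow>
     (\<forall>(U, c)\<in>atlas M. smooth_on (T \<times> c ` U) (\<lambda>(t, x). H t (inv_into U c x)))"

definition smooth_maps :: "('p, 'e::euclidean_space) smanifold \<Rightarrow> ('p \<Rightarrow> 'p) set" where
  "smooth_maps M =
     {f \<in> pts M \<rightarrow>\<^sub>E pts M.
        \<forall>(U, c)\<in>atlas M. \<forall>(V, d)\<in>atlas M.
          let S = {x \<in> c ` U. f (inv_into U c x) \<in> V}
          in open S \<and> smooth_on S (\<lambda>x. d (f (inv_into U c x)))}"

definition diffeos :: "('p, 'e::euclidean_space) smanifold \<Rightarrow> ('p \<Rightarrow> 'p) set" where
  "diffeos M =
     {f \<in> smooth_maps M. bij_betw f (pts M) (pts M) \<and>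
        restrict (inv_into (pts M) f) (pts M) \<in> smooth_maps M}"

text \<open>Isotopies integrating the Hamiltonian vector fields \<open>X\<^sub>t\<close> of a time-dependent Hamiltonian,
  with the sign convention \<open>\<omega>(X\<^sub>t, \<cdot>) = - dH\<^sub>t\<close>.\<close>

definition ham_isotopy ::
  "('p, 'e::euclidean_space) smanifold \<Rightarrow> (real \<Rightarrow> 'p \<Rightarrow> real) \<Rightarrow> (real \<Rightarrow> 'p \<Rightarrow> 'p) \<Rightarrow> bool" where
  "ham_isotopy M H \<Phi> \<longleftrightarrow>
     smooth_fun_family M {0..1} H \<and>
     smooth_family M {0..1} \<Phi> \<and>
     (\<forall>t\<in>{0..1}. \<Phi> t \<in> diffeos M) \<and>
     (\<forall>p\<in>pts M. \<Phi> 0 p = p) \<and>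
     (\<forall>(U, c)\<in>atlas M. \<forall>t\<in>{0..1}. \<forall>p\<in>pts M. \<Phi> t p \<in> U \<longrightarrow>
        (\<exists>X. ((\<lambda>r. c (\<Phi> r p)) has_vector_derivative X) (at t within {0..1}) \<and>
             (\<forall>w. sform M (U, c) (c (\<Phi> t p)) X w =
                - frechet_derivative (\<lambda>x. H t (inv_into U c x)) (at (c (\<Phi> t p))) w)))"

definition Ham :: "('p, 'e::euclidean_space) smanifold \<Rightarrow> ('p \<Rightarrow> 'p) set" where
  "Ham M = {f. \<exists>H \<Phi>. ham_isotopy M H \<Phi> \<and> f = \<Phi> 1}"

text \<open>A subbasic neighbourhood of \<open>f\<close>: the maps that are \<open>e\<close>-close to \<open>f\<close> on the compact coordinate
  set \<open>K\<close>, together with all partial derivatives of order at most \<open>r\<close>.\<close>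

definition cinf_nbhd ::
  "('p, 'e::euclidean_space) smanifold \<Rightarrow> ('p \<Rightarrow> 'p) \<Rightarrow> ('p, 'e) chart \<Rightarrow> ('p, 'e) chart
     \<Rightarrow> 'e set \<Rightarrow> nat \<Rightarrow> real \<Rightarrow> ('p \<Rightarrow> 'p) set" where
  "cinf_nbhd M f C D K r e =
     (case C of (U, c) \<Rightarrow> case D of (V, d) \<Rightarrow>
       {g \<in> smooth_maps M. g ` inv_into U c ` K \<subseteq> V \<and>
          (\<forall>vs. set vs \<subseteq> Basis \<and> length vs \<le> r \<longrightarrow>
            (\<forall>x\<in>K. norm (iter_deriv vs (\<lambda>y. d (g (inv_into U c y))) x
                       - iter_deriv vs (\<lambda>y. d (f (inv_into U c y))) x) < e))})"

definition cinf_topology ::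
  "('p, 'e::euclidean_space) smanifold \<Rightarrow> ('p \<Rightarrow> 'p) topology" where
  "cinf_topology M =
     topology_generated_by
       (insert (smooth_maps M)
         {cinf_nbhd M f (U, c) (V, d) K r e | f U c V d K r e.
            f \<in> smooth_maps M \<and> (U, c) \<in> atlas M \<and> (V, d) \<in> atlas M \<and>
            compact K \<and> K \<subseteq> c ` U \<and> f ` inv_into U c ` K \<subseteq> V \<and> 0 < e})"

definition Ham_topology ::
  "('p, 'e::euclidean_space) smanifold \<Rightarrow> ('p \<Rightarrow> 'p) topology" where
  "Ham_topology M = subtopology (cinf_topology M) (Ham M)"

text \<open>A homomorphism into the infinite-dimensional group \<open>Ham M\<close> is smooth when the associated
  action map \<open>U(1) \<times> M \<rightarrow> M\<close> is.\<close>

definition circle_hom ::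
  "('p, 'e::euclidean_space) smanifold \<Rightarrow> (complex \<Rightarrow> 'p \<Rightarrow> 'p) \<Rightarrow> bool" where
  "circle_hom M \<phi> \<longleftrightarrow>
     \<phi> ` U1 \<subseteq> Ham M \<and>
     (\<forall>u\<in>U1. \<forall>v\<in>U1. \<phi> (u * v) = compose (pts M) (\<phi> u) (\<phi> v)) \<and>
     smooth_family M U1 \<phi>"

definition hom_homotopic ::
  "('p, 'e::euclidean_space) smanifold \<Rightarrow> (complex \<Rightarrow> 'p \<Rightarrow> 'p) \<Rightarrow> (complex \<Rightarrow> 'p \<Rightarrow> 'p) \<Rightarrow> bool"
  where
  "hom_homotopic M \<phi> \<phi>' \<longleftrightarrow>
     circle_hom M \<phi> \<and> circle_hom M \<phi>' \<and>
     (\<exists>\<Phi> :: real \<Rightarrow> complex \<Rightarrow> 'p \<Rightarrow> 'p.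
        (\<forall>s\<in>{0..1}. circle_hom M (\<Phi> s)) \<and>
        continuous_map (top_of_set ({0..1} \<times> U1)) (Ham_topology M) (\<lambda>(s, u). \<Phi> s u) \<and>
        (\<forall>u\<in>U1. \<Phi> 0 u = \<phi> u) \<and> (\<forall>u\<in>U1. \<Phi> 1 u = \<phi>' u))"

section \<open>Symplectic quotients\<close>

text \<open>The maximal atlas of the manifold structure on \<open>Z // R\<close> for which \<open>z \<mapsto> R `` {z}\<close> is a
  submersion: a chart is smooth after composition with this projection, and its inverse lifts
  locally to smooth maps into \<open>Z\<close>.\<close>

definition quotient_atlas ::
  "'v::euclidean_space set \<Rightarrow> ('v \<times> 'v) set \<Rightarrow> ('v set, 'e::euclidean_space) chart set" where
  "quotient_atlas Z R =
     {(U, c). U \<subseteq> Z // R \<and> inj_on c U \<and> open (c ` U) \<and>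
        openin (top_of_set Z) {z \<in> Z. R `` {z} \<in> U} \<and>
        smooth_on {z \<in> Z. R `` {z} \<in> U} (\<lambda>z. c (R `` {z})) \<and>
        (\<forall>x\<in>c ` U. \<exists>V s. open V \<and> x \<in> V \<and> V \<subseteq> c ` U \<and> smooth_on V s \<and> s ` V \<subseteq> Z \<and>
           (\<forall>y\<in>V. R `` {s y} = inv_into U c y))}"

definition smooth_curve_through ::
  "'v::real_normed_vector set \<Rightarrow> 'v \<Rightarrow> (real \<Rightarrow> 'v) \<Rightarrow> bool" where
  "smooth_curve_through Z z \<gamma> \<longleftrightarrow>
     \<gamma> 0 = z \<and> (\<exists>e>0. smooth_on {-e<..<e} \<gamma> \<and> \<gamma> ` {-e<..<e} \<subseteq> Z)"

text \<open>The reduced form is the form whose pull-back to \<open>Z\<close> is the restriction of \<open>\<omega>\<close>; tangent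
  vectors of \<open>Z\<close> and their images in the quotient are velocities of smooth curves.\<close>

definition reduced_form ::
  "'v::euclidean_space set \<Rightarrow> ('v \<times> 'v) set \<Rightarrow> ('v \<Rightarrow> 'v \<Rightarrow> real)
     \<Rightarrow> ('v set, 'e::euclidean_space) chart \<Rightarrow> 'e \<Rightarrow> 'e \<Rightarrow> 'e \<Rightarrow> real" where
  "reduced_form Z R \<omega> C x =
     (case C of (U, c) \<Rightarrow>
       THE B. \<forall>z \<gamma> \<delta> v w v' w'.
         z \<in> Z \<and> R `` {z} \<in> U \<and> c (R `` {z}) = x \<and>
         smooth_curve_through Z z \<gamma> \<and> smooth_curve_through Z z \<delta> \<and>
         (\<gamma> has_vector_derivative v) (at 0) \<and> (\<delta> has_vector_derivative w) (at 0) \<and>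
         ((\<lambda>r. c (R `` {\<gamma> r})) has_vector_derivative v') (at 0) \<and>
         ((\<lambda>r. c (R `` {\<delta> r})) has_vector_derivative w') (at 0)
         \<longrightarrow> B v' w' = \<omega> v w)"

text \<open>The standard form \<open>\<Sum> dx\<^sub>i \<and> dy\<^sub>i\<close>. With the above sign convention the Hamiltonian of the
  rotation \<open>z\<^sub>i \<mapsto> e\<^bsup>2\<pi>it\<^esup> z\<^sub>i\<close> is \<open>\<pi>\<bar>z\<^sub>i\<bar>\<^sup>2\<close>.\<close>

definition omega_std :: "complex ^ 'i::finite \<Rightarrow> complex ^ 'i \<Rightarrow> real" where
  "omega_std v w = (\<Sum>i\<in>UNIV. Im (cnj (v $ i) * w $ i))"

section \<open>The toric manifold\<close>

text \<open>The type \<open>'k\<close> plays the role of the index set \<open>{1,\<dots>,n}\<close>, and \<open>l :: 'k\<close> that of the index \<open>n\<close>;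
  \<open>Inr False\<close> and \<open>Inr True\<close> are the indices \<open>n+1\<close> and \<open>n+2\<close>. The value \<open>a l\<close> is never used.\<close>

type_synonym 'k ambient = "complex ^ ('k + bool)"

definition level_set :: "('k::finite \<Rightarrow> int) \<Rightarrow> 'k \<Rightarrow> real \<Rightarrow> real \<Rightarrow> 'k ambient set" where
  "level_set a l \<sigma> \<tau> =
     {z. (\<Sum>j\<in>UNIV - {l}. (cmod (z $ Inl j))\<^sup>2) + (cmod (z $ Inr False))\<^sup>2 = \<sigma> / pi \<and>
         - (\<Sum>j\<in>UNIV - {l}. of_int (a j) * (cmod (z $ Inl j))\<^sup>2)
           + (cmod (z $ Inl l))\<^sup>2 + (cmod (z $ Inr True))\<^sup>2 = \<tau> / pi}"

definition orbit_rel ::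
  "('k::finite \<Rightarrow> int) \<Rightarrow> 'k \<Rightarrow> real \<Rightarrow> real \<Rightarrow> ('k ambient \<times> 'k ambient) set" where
  "orbit_rel a l \<sigma> \<tau> =
     {(z, z'). z \<in> level_set a l \<sigma> \<tau> \<and> z' \<in> level_set a l \<sigma> \<tau> \<and>
        (\<exists>\<epsilon>\<in>U1. \<exists>\<mu>\<in>U1.
           (\<forall>j. j \<noteq> l \<longrightarrow> z' $ Inl j = \<mu> * \<epsilon> powi (- a j) * z $ Inl j) \<and>
           z' $ Inl l = \<epsilon> * z $ Inl l \<and>
           z' $ Inr True = \<epsilon> * z $ Inr True \<and>
           z' $ Inr False = \<mu> * z $ Inr False)}"

definition toric_manifold ::
  "('k::finite \<Rightarrow> int) \<Rightarrow> 'k \<Rightarrow> real \<Rightarrow> real \<Rightarrow> ('k ambient set, complex ^ 'k) smanifold" where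
  "toric_manifold a l \<sigma> \<tau> =
     \<lparr> pts = level_set a l \<sigma> \<tau> // orbit_rel a l \<sigma> \<tau>,
       atlas = quotient_atlas (level_set a l \<sigma> \<tau>) (orbit_rel a l \<sigma> \<tau>),
       sform = reduced_form (level_set a l \<sigma> \<tau>) (orbit_rel a l \<sigma> \<tau>) omega_std \<rparr>"

definition rotate_coords :: "int ^ 'k::finite \<Rightarrow> complex \<Rightarrow> 'k ambient \<Rightarrow> 'k ambient" where
  "rotate_coords b u z =
     (\<chi> i. case i of Inl j \<Rightarrow> u powi (b $ j) * z $ Inl j | Inr _ \<Rightarrow> z $ i)"

text \<open>The circle action as a function of \<open>u = e\<^bsup>2\<pi>it\<^esup>\<close>: a class is sent to the class of its rotated
  representatives (see the lemma \<open>psi_class\<close> below).\<close>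

definition psi ::
  "('k::finite \<Rightarrow> int) \<Rightarrow> 'k \<Rightarrow> real \<Rightarrow> real \<Rightarrow> int ^ 'k \<Rightarrow> complex \<Rightarrow> 'k ambient set \<Rightarrow> 'k ambient set"
  where
  "psi a l \<sigma> \<tau> b u =
     restrict (\<lambda>X. rotate_coords b u ` X) (pts (toric_manifold a l \<sigma> \<tau>))"

definition lattice_equiv ::
  "('k::finite \<Rightarrow> int) \<Rightarrow> 'k \<Rightarrow> int ^ 'k \<Rightarrow> int ^ 'k \<Rightarrow> bool" where
  "lattice_equiv a l b b' \<longleftrightarrow>
     b = b' \<or> (\<forall>j. j \<noteq> l \<longrightarrow> b' $ j = b $ j + a j * b $ l) \<and> b' $ l = - b $ l"

lemma orbit_relI:
  assumes "z \<in> level_set a l \<sigma> \<tau>" "w \<in> level_set a l \<sigma> \<tau>" "\<epsilon> \<in> U1" "\<mu> \<in> U1"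
    and "\<And>j. j \<noteq> l \<Longrightarrow> w $ Inl j = \<mu> * \<epsilon> powi (- a j) * z $ Inl j"
    and "w $ Inl l = \<epsilon> * z $ Inl l" "w $ Inr True = \<epsilon> * z $ Inr True"
    and "w $ Inr False = \<mu> * z $ Inr False"
  shows "(z, w) \<in> orbit_rel a l \<sigma> \<tau>"
  using assms unfolding orbit_rel_def by blast

lemma equiv_orbit_rel: "equiv (level_set a l \<sigma> \<tau>) (orbit_rel a l \<sigma> \<tau>)"
proof (rule equivI)
  let ?R = "orbit_rel a l \<sigma> \<tau>"
  show "?R \<subseteq> level_set a l \<sigma> \<tau> \<times> level_set a l \<sigma> \<tau>"
    by (auto simp: orbit_rel_def)
  show "refl_on (level_set a l \<sigma> \<tau>) ?R"
    by (auto simp: refl_on_def orbit_rel_def intro!: bexI[of _ 1])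
  show "sym ?R"
  proof (rule symI)
    fix z w assume "(z, w) \<in> ?R"
    then obtain \<epsilon> \<mu> where *: "\<epsilon> \<in> U1" "\<mu> \<in> U1"
      "\<forall>j. j \<noteq> l \<longrightarrow> w $ Inl j = \<mu> * \<epsilon> powi (- a j) * z $ Inl j"
      "w $ Inl l = \<epsilon> * z $ Inl l" "w $ Inr True = \<epsilon> * z $ Inr True"
      "w $ Inr False = \<mu> * z $ Inr False"
      and Z: "z \<in> level_set a l \<sigma> \<tau>" "w \<in> level_set a l \<sigma> \<tau>"
      unfolding orbit_rel_def by blast
    have nz: "\<epsilon> \<noteq> 0" "\<mu> \<noteq> 0" using *(1,2) by auto
    have i: "inverse \<epsilon> \<in> U1" "inverse \<mu> \<in> U1" using *(1,2) by (auto simp: norm_inverse)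
    have "inverse \<mu> * inverse \<epsilon> powi (- a j) * (\<mu> * \<epsilon> powi (- a j) * z $ Inl j) = z $ Inl j" for j
      using nz by (simp add: power_int_minus field_simps)
    then show "(w, z) \<in> ?R"
      using * nz i Z by (intro orbit_relI[of _ _ _ _ _ _ "inverse \<epsilon>" "inverse \<mu>"]) simp_all
  qed
  show "trans ?R"
  proof (rule transI)
    fix x z w assume "(x, z) \<in> ?R" "(z, w) \<in> ?R"
    then obtain \<epsilon> \<mu> \<epsilon>' \<mu>' where *: "\<epsilon> \<in> U1" "\<mu> \<in> U1"
      "\<forall>j. j \<noteq> l \<longrightarrow> z $ Inl j = \<mu> * \<epsilon> powi (- a j) * x $ Inl j"
      "z $ Inl l = \<epsilon> * x $ Inl l" "z $ Inr True = \<epsilon> * x $ Inr True"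
      "z $ Inr False = \<mu> * x $ Inr False"
      and **: "\<epsilon>' \<in> U1" "\<mu>' \<in> U1"
      "\<forall>j. j \<noteq> l \<longrightarrow> w $ Inl j = \<mu>' * \<epsilon>' powi (- a j) * z $ Inl j"
      "w $ Inl l = \<epsilon>' * z $ Inl l" "w $ Inr True = \<epsilon>' * z $ Inr True"
      "w $ Inr False = \<mu>' * z $ Inr False"
      and Z: "x \<in> level_set a l \<sigma> \<tau>" "w \<in> level_set a l \<sigma> \<tau>"
      unfolding orbit_rel_def by blast
    have "\<epsilon>' * \<epsilon> \<in> U1" "\<mu>' * \<mu> \<in> U1" using * ** by (auto simp: norm_mult)
    then show "(x, w) \<in> ?R"
      using * ** Z
      by (intro orbit_relI[of _ _ _ _ _ _ "\<epsilon>' * \<epsilon>" "\<mu>' * \<mu>"])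
        (simp_all add: power_int_mult_distrib)
  qed
qed

lemma rotate_coords_level_set:
  assumes "u \<in> U1" "z \<in> level_set a l \<sigma> \<tau>"
  shows "rotate_coords b u z \<in> level_set a l \<sigma> \<tau>"
  using assms by (simp add: level_set_def rotate_coords_def norm_mult norm_power_int)

lemma rotate_coords_orbit_rel:
  assumes u: "u \<in> U1" and zw: "(z, w) \<in> orbit_rel a l \<sigma> \<tau>"
  shows "(rotate_coords b u z, rotate_coords b u w) \<in> orbit_rel a l \<sigma> \<tau>"
proof -
  obtain \<epsilon> \<mu> where "\<epsilon> \<in> U1" "\<mu> \<in> U1"
    "\<forall>j. j \<noteq> l \<longrightarrow> w $ Inl j = \<mu> * \<epsilon> powi (- a j) * z $ Inl j"
    "w $ Inl l = \<epsilon> * z $ Inl l" "w $ Inr True = \<epsilon> * z $ Inr True"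
    "w $ Inr False = \<mu> * z $ Inr False"
    and "z \<in> level_set a l \<sigma> \<tau>" "w \<in> level_set a l \<sigma> \<tau>"
    using zw unfolding orbit_rel_def by blast
  then show ?thesis
    using rotate_coords_level_set[OF u]
    by (intro orbit_relI[of _ _ _ _ _ _ \<epsilon> \<mu>]) (simp_all add: rotate_coords_def)
qed

lemma psi_class:
  assumes z: "z \<in> level_set a l \<sigma> \<tau>"
  shows "psi a l \<sigma> \<tau> b (cis (2 * pi * t)) (orbit_rel a l \<sigma> \<tau> `` {z}) =
    orbit_rel a l \<sigma> \<tau> ``
      {\<chi> i. case i of Inl j \<Rightarrow> exp (2 * pi * \<i> * of_int (b $ j) * t) * z $ Inl j | Inr _ \<Rightarrow> z $ i}"
proof -
  let ?u = "cis (2 * pi * t)" and ?R = "orbit_rel a l \<sigma> \<tau>"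
  have u: "?u \<in> U1" "inverse ?u \<in> U1" by (auto simp: norm_inverse)
  have "?u powi k * (inverse ?u powi k * y) = y" "inverse ?u powi k * (?u powi k * y) = y" for k y
    by (simp_all add: power_int_inverse del: cis_inverse)
  then have inv: "rotate_coords b ?u (rotate_coords b (inverse ?u) w) = w"
    and inv': "rotate_coords b (inverse ?u) (rotate_coords b ?u w) = w" for w
    by (simp_all add: rotate_coords_def vec_eq_iff del: cis_inverse split: sum.split)
  have img: "rotate_coords b ?u ` (?R `` {z}) = ?R `` {rotate_coords b ?u z}"
  proof
    show "rotate_coords b ?u ` (?R `` {z}) \<subseteq> ?R `` {rotate_coords b ?u z}"
      using rotate_coords_orbit_rel[OF u(1)] by blast
    show "?R `` {rotate_coords b ?u z} \<subseteq> rotate_coords b ?u ` (?R `` {z})"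
    proof
      fix w assume "w \<in> ?R `` {rotate_coords b ?u z}"
      then have "(z, rotate_coords b (inverse ?u) w) \<in> ?R"
        using rotate_coords_orbit_rel[OF u(2), of "rotate_coords b ?u z" w a l \<sigma> \<tau> b]
        unfolding inv' by blast
      then show "w \<in> rotate_coords b ?u ` (?R `` {z})"
        using inv by (metis Image_singleton_iff image_eqI)
    qed
  qed
  have powi_eq: "?u powi k = exp (2 * pi * \<i> * of_int k * t)" for k
  proof -
    have "?u powi k = cis (of_int k * (2 * pi * t))" by (rule cis_power_int)
    then show ?thesis by (simp add: cis_conv_exp mult_ac)
  qed
  have rot: "rotate_coords b ?u z =
      (\<chi> i. case i of Inl j \<Rightarrow> exp (2 * pi * \<i> * of_int (b $ j) * t) * z $ Inl j | Inr _ \<Rightarrow> z $ i)"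
    by (auto simp: rotate_coords_def vec_eq_iff powi_eq split: sum.split)
  show ?thesis
    unfolding rot[symmetric] using z img by (simp add: psi_def toric_manifold_def quotientI)
qed

end

theory Submission
  imports Defs
begin

text \<open>The action \<open>\<psi>\<^sub>b\<close> is induced by a diagonal rotation of the ambient space. The coordinates of index
  \<open>n\<close> and \<open>n + 2\<close> have the same weights for the torus by which the level set is divided, so the unitary
  group of the plane that they span acts on the quotient. Conjugating the diagonal rotation by
  the real rotations of this plane through the angles from \<open>0\<close> to \<open>\<pi> / 2\<close> gives a path of
  circle actions. At its end the factor \<open>u powi b\<^sub>n\<close> acts on coordinate \<open>n + 2\<close> instead of coordinate \<open>n\<close>;
  multiplying by the torus element with \<open>\<epsilon> = u powi (- b\<^sub>n)\<close> moves it back with the opposite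
  sign and multiplies coordinate \<open>j\<close> by \<open>u powi (a\<^sub>j * b\<^sub>n)\<close>. This is the action of \<open>b'\<close>.

  The rest of the proof shows that this path is a homotopy of homomorphisms into the Hamiltonian
  group. Maps of a quotient are smooth because charts are smooth on the total space and
  inverse charts lift to it (\<open>smooth_family_induced\<close>); this rests on a calculus of smooth functions on
  arbitrary sets, whose main point is closure under composition. The reduced form exists because the
  torus acts freely and its orbits are orthogonal, with respect to the symplectic form, to the level
  set of its moment map (\<open>orbit_directions_null\<close>, \<open>reduced_form_eq\<close>). Each map of the path is the
  time-one map of an invariant quadratic Hamiltonian on the ambient space, and Hamilton's equation
  descends (\<open>ham_isotopy_induced\<close>). Finally, a family that is jointly smooth in its parameters is continuous in
  the \<open>C\<^sup>\<infinity>\<close> topology, by a compactness argument (\<open>smooth_family_continuous_cinf\<close>).\<close>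

section \<open>Calculus of smooth functions on arbitrary sets\<close>

text \<open>Differentiability of all iterated directional derivatives of order at most \<open>k\<close>. Closure properties
  of smoothness are proved at each finite order, where the derivative of a composite is built from
  functions to which the induction hypothesis applies.\<close>

definition kdiff :: "nat \<Rightarrow> 'a::real_normed_vector set \<Rightarrow> ('a \<Rightarrow> 'b::real_normed_vector) \<Rightarrow> bool" where
  "kdiff k W F \<longleftrightarrow> (\<forall>vs. length vs \<le> k \<longrightarrow> (\<forall>y\<in>W. iter_deriv vs F differentiable (at y)))"

definition smooth_open :: "'a::real_normed_vector set \<Rightarrow> ('a \<Rightarrow> 'b::real_normed_vector) \<Rightarrow> bool" where
  "smooth_open W F \<longleftrightarrow> (\<forall>vs. \<forall>y\<in>W. iter_deriv vs F differentiable (at y))"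

lemma smooth_open_iff_kdiff: "smooth_open W F \<longleftrightarrow> (\<forall>k. kdiff k W F)"
  unfolding smooth_open_def kdiff_def by blast

lemma smooth_on_iff:
  "smooth_on S f \<longleftrightarrow>
     (\<forall>x\<in>S. \<exists>W F. open W \<and> x \<in> W \<and> smooth_open W F \<and> (\<forall>y\<in>W \<inter> S. F y = f y))"
  unfolding smooth_on_def smooth_open_def by blast

lemma kdiff_0: "kdiff 0 W F \<longleftrightarrow> (\<forall>y\<in>W. F differentiable (at y))"
  by (simp add: kdiff_def)

lemma kdiff_Suc:
  "kdiff (Suc k) W F \<longleftrightarrow>
     (\<forall>y\<in>W. F differentiable (at y)) \<and> (\<forall>v. kdiff k W (\<lambda>x. frechet_derivative F (at x) v))"
proof
  assume *: "kdiff (Suc k) W F"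
  have "iter_deriv vs (\<lambda>x. frechet_derivative F (at x) v) differentiable (at y)"
    if "length vs \<le> k" "y \<in> W" for v vs y
    using *[unfolded kdiff_def, rule_format, of "v # vs" y] that by simp
  moreover have "F differentiable (at y)" if "y \<in> W" for y
    using *[unfolded kdiff_def, rule_format, of "[]" y] that by simp
  ultimately show "(\<forall>y\<in>W. F differentiable (at y)) \<and>
      (\<forall>v. kdiff k W (\<lambda>x. frechet_derivative F (at x) v))"
    by (simp add: kdiff_def)
next
  assume *: "(\<forall>y\<in>W. F differentiable (at y)) \<and>
      (\<forall>v. kdiff k W (\<lambda>x. frechet_derivative F (at x) v))"
  show "kdiff (Suc k) W F"
    unfolding kdiff_def
  proof (intro allI impI ballI)
    fix vs :: "'a list" and y assume "length vs \<le> Suc k" "y \<in> W"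
    then show "iter_deriv vs F differentiable (at y)"
      using * by (cases vs) (auto simp: kdiff_def)
  qed
qed

lemma kdiff_SucI:
  assumes "\<And>y. y \<in> W \<Longrightarrow> F differentiable (at y)"
    and "\<And>v. kdiff k W (\<lambda>x. frechet_derivative F (at x) v)"
  shows "kdiff (Suc k) W F"
  using assms by (simp add: kdiff_Suc)

lemma kdiff_differentiable: "kdiff k W F \<Longrightarrow> y \<in> W \<Longrightarrow> F differentiable (at y)"
  by (cases k) (auto simp: kdiff_0 kdiff_Suc)

lemma kdiff_SucD: "kdiff (Suc k) W F \<Longrightarrow> kdiff k W F"
  by (auto simp: kdiff_def)

lemma kdiff_subset: "kdiff k W F \<Longrightarrow> V \<subseteq> W \<Longrightarrow> kdiff k V F"
  by (auto simp: kdiff_def)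

lemma frechet_derivative_cong_open:
  assumes "open W" "y \<in> W" "\<And>x. x \<in> W \<Longrightarrow> F x = G x"
  shows "frechet_derivative F (at y) = frechet_derivative G (at y)"
proof -
  have "(F has_derivative D) (at y) \<longleftrightarrow> (G has_derivative D) (at y)" for D
    using assms has_derivative_transform_within_open[of F D y UNIV W G]
      has_derivative_transform_within_open[of G D y UNIV W F] by auto
  then show ?thesis by (simp add: frechet_derivative_def)
qed

lemma iter_deriv_cong_open:
  assumes "open W" "y \<in> W" "\<And>x. x \<in> W \<Longrightarrow> F x = G x"
  shows "iter_deriv vs F y = iter_deriv vs G y"
  using assms(2,3)
proof (induction vs arbitrary: F G y)
  case (Cons v vs)
  have "frechet_derivative F (at x) v = frechet_derivative G (at x) v" if "x \<in> W" for x
    using frechet_derivative_cong_open[OF assms(1) that Cons.prems(2)] by simp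
  from Cons.IH[OF Cons.prems(1) this] show ?case by simp
qed simp

lemma differentiable_cong_open:
  assumes "open W" "y \<in> W" "\<And>x. x \<in> W \<Longrightarrow> F x = G x" "F differentiable (at y)"
  shows "G differentiable (at y)"
proof -
  obtain D where "(F has_derivative D) (at y)" using assms(4) by (auto simp: differentiable_def)
  then have "(G has_derivative D) (at y)"
    using has_derivative_transform_within_open[OF _ assms(1,2)] assms(3) by blast
  then show ?thesis by (rule differentiableI)
qed

lemma kdiff_cong:
  assumes "open W" "\<And>x. x \<in> W \<Longrightarrow> F x = G x" "kdiff k W F"
  shows "kdiff k W G"
  unfolding kdiff_def
proof (intro allI impI ballI)
  fix vs :: "'a list" and y assume *: "length vs \<le> k" "y \<in> W"
  show "iter_deriv vs G differentiable (at y)"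
  proof (rule differentiable_cong_open[OF assms(1) *(2)])
    show "iter_deriv vs F x = iter_deriv vs G x" if "x \<in> W" for x
      using assms(2) by (intro iter_deriv_cong_open[OF assms(1) that]) auto
    show "iter_deriv vs F differentiable (at y)"
      using assms(3) * by (simp add: kdiff_def)
  qed
qed

text \<open>The induction step of all closure proofs: it suffices to exhibit the derivative, in
  whatever form, and to know that each of its directional values is differentiable one order less.\<close>

lemma kdiff_SucI_derivative:
  assumes "open W" "\<And>y. y \<in> W \<Longrightarrow> (F has_derivative D y) (at y)"
    and "\<And>v. kdiff k W (\<lambda>y. D y v)"
  shows "kdiff (Suc k) W F"
proof (rule kdiff_SucI)
  show "F differentiable (at y)" if "y \<in> W" for y
    using assms(2)[OF that] by (auto simp: differentiable_def)
  show "kdiff k W (\<lambda>x. frechet_derivative F (at x) v)" for v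
  proof (rule kdiff_cong[OF assms(1) _ assms(3)])
    show "D x v = frechet_derivative F (at x) v" if "x \<in> W" for x
      using frechet_derivative_at[OF assms(2)[OF that]] by simp
  qed
qed

lemma kdiff_has_derivative:
  "kdiff k W F \<Longrightarrow> y \<in> W \<Longrightarrow> (F has_derivative frechet_derivative F (at y)) (at y)"
  by (metis kdiff_differentiable frechet_derivative_works)

lemma kdiff_const: "kdiff k W (\<lambda>x. c)"
  by (induction k arbitrary: c) (auto simp: kdiff_0 kdiff_Suc)

lemma kdiff_bounded_linear:
  assumes "bounded_linear L" "open W" "kdiff k W f"
  shows "kdiff k W (\<lambda>x. L (f x))"
  using assms(3)
proof (induction k arbitrary: f)
  case 0
  then show ?case
    using bounded_linear.has_derivative[OF assms(1) kdiff_has_derivative[OF 0]]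
    by (auto simp: kdiff_0 intro: differentiableI)
next
  case (Suc k)
  show ?case
  proof (rule kdiff_SucI_derivative[OF assms(2)])
    show "((\<lambda>x. L (f x)) has_derivative (\<lambda>v. L (frechet_derivative f (at y) v))) (at y)"
      if "y \<in> W" for y
      by (rule bounded_linear.has_derivative[OF assms(1) kdiff_has_derivative[OF Suc.prems that]])
    show "kdiff k W (\<lambda>y. L (frechet_derivative f (at y) v))" for v
      using Suc.prems by (intro Suc.IH) (simp add: kdiff_Suc)
  qed
qed

lemma kdiff_ident: "kdiff k W (\<lambda>x. x)"
proof (cases k)
  case (Suc m)
  then show ?thesis by (auto simp: kdiff_Suc kdiff_const)
qed (simp add: kdiff_0)

lemma kdiff_add:
  assumes "open W" "kdiff k W f" "kdiff k W g"
  shows "kdiff k W (\<lambda>x. f x + g x)"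
  using assms(2,3)
proof (induction k arbitrary: f g)
  case 0
  then show ?case by (auto simp: kdiff_0)
next
  case (Suc k)
  show ?case
  proof (rule kdiff_SucI_derivative[OF assms(1)])
    show "((\<lambda>x. f x + g x) has_derivative
        (\<lambda>v. frechet_derivative f (at y) v + frechet_derivative g (at y) v)) (at y)"
      if "y \<in> W" for y
      by (rule has_derivative_add[OF Suc.prems[THEN kdiff_has_derivative[OF _ that]]])
    show "kdiff k W (\<lambda>y. frechet_derivative f (at y) v + frechet_derivative g (at y) v)" for v
      using Suc.prems by (intro Suc.IH) (simp_all add: kdiff_Suc)
  qed
qed

lemma kdiff_sum:
  assumes "open W" "\<And>i. i \<in> I \<Longrightarrow> kdiff k W (f i)"
  shows "kdiff k W (\<lambda>x. \<Sum>i\<in>I. f i x)"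
  using assms(2)
  by (induction I rule: infinite_finite_induct) (auto simp: kdiff_const intro!: kdiff_add[OF assms(1)])

lemma kdiff_bilinear:
  fixes B :: "'b::real_normed_vector \<Rightarrow> 'c::real_normed_vector \<Rightarrow> 'd::real_normed_vector"
    and f :: "'a::real_normed_vector \<Rightarrow> 'b" and g :: "'a \<Rightarrow> 'c"
  assumes "bounded_bilinear B" "open W" "kdiff k W f" "kdiff k W g"
  shows "kdiff k W (\<lambda>x. B (f x) (g x))"
proof -
  have d: "((\<lambda>x. B (f x) (g x)) has_derivative
        (\<lambda>v. B (f y) (frechet_derivative g (at y) v) + B (frechet_derivative f (at y) v) (g y))) (at y)"
    if "f differentiable (at y)" "g differentiable (at y)"
    for y and f :: "'a \<Rightarrow> 'b" and g :: "'a \<Rightarrow> 'c"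
    by (rule bounded_bilinear.FDERIV[OF assms(1)]) (use that in \<open>simp_all flip: frechet_derivative_works\<close>)
  have "kdiff k W (\<lambda>x. B (f x) (g x))" if "kdiff k W f" "kdiff k W g"
    for f :: "'a \<Rightarrow> 'b" and g :: "'a \<Rightarrow> 'c"
    using that
  proof (induction k arbitrary: f g)
    case 0
    then show ?case by (auto simp: kdiff_0 intro: differentiableI[OF d])
  next
    case (Suc k)
    show ?case
    proof (rule kdiff_SucI_derivative[OF assms(2) d])
      fix v
      show "kdiff k W (\<lambda>y. B (f y) (frechet_derivative g (at y) v) +
          B (frechet_derivative f (at y) v) (g y))"
        using Suc.prems by (intro kdiff_add[OF assms(2)] Suc.IH) (simp_all add: kdiff_Suc kdiff_SucD)
    qed (use Suc.prems kdiff_differentiable in auto)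
  qed
  then show ?thesis using assms by blast
qed

text \<open>Expanding the inner derivative in an orthonormal basis turns the chain rule into a finite sum of
  products of functions that are differentiable of one order less; this is why the middle space is
  Euclidean.\<close>

lemma kdiff_compose:
  fixes f :: "'a::real_normed_vector \<Rightarrow> 'b::euclidean_space" and g :: "'b \<Rightarrow> 'c::real_normed_vector"
  assumes "open W" "open V" "f ` W \<subseteq> V" "kdiff k W f" "kdiff k V g"
  shows "kdiff k W (\<lambda>x. g (f x))"
  using assms(4,5)
proof (induction k arbitrary: g)
  case 0
  show ?case
    unfolding kdiff_0
  proof
    fix y assume "y \<in> W"
    then show "(\<lambda>x. g (f x)) differentiable (at y)"
      using 0 assms(3) differentiable_chain_at[of f y g] by (auto simp: kdiff_0 o_def)
  qed
next
  case (Suc k)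
  have d: "((\<lambda>x. g (f x)) has_derivative
      (\<lambda>v. \<Sum>b\<in>Basis. (frechet_derivative f (at y) v \<bullet> b) *\<^sub>R frechet_derivative g (at (f y)) b)) (at y)"
    if y: "y \<in> W" for y
  proof -
    let ?f = "frechet_derivative f (at y)" and ?g = "frechet_derivative g (at (f y))"
    have g: "(g has_derivative ?g) (at (f y))"
      using kdiff_has_derivative[OF Suc.prems(2)] y assms(3) by auto
    then interpret bounded_linear ?g by (rule has_derivative_bounded_linear)
    have "?g (?f v) = (\<Sum>b\<in>Basis. (?f v \<bullet> b) *\<^sub>R ?g b)" for v
      by (subst euclidean_representation[symmetric, of "?f v"]) (simp add: sum scaleR)
    with diff_chain_at[OF kdiff_has_derivative[OF Suc.prems(1) y] g] show ?thesis
      by (simp add: o_def)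
  qed
  show ?case
  proof (rule kdiff_SucI_derivative[OF assms(1) d])
    fix v
    show "kdiff k W (\<lambda>y. \<Sum>b\<in>Basis.
        (frechet_derivative f (at y) v \<bullet> b) *\<^sub>R frechet_derivative g (at (f y)) b)"
    proof (rule kdiff_sum[OF assms(1)], rule kdiff_bilinear[OF bounded_bilinear_scaleR assms(1)])
      fix b :: 'b
      show "kdiff k W (\<lambda>y. frechet_derivative f (at y) v \<bullet> b)"
        using Suc.prems(1)
        by (intro kdiff_bounded_linear[OF bounded_linear_inner_left assms(1)]) (simp add: kdiff_Suc)
      show "kdiff k W (\<lambda>y. frechet_derivative g (at (f y)) b)"
        using Suc.prems by (intro Suc.IH) (auto simp: kdiff_Suc kdiff_SucD)
    qed
  qed
qed

text \<open>The constant factor makes the family closed under differentiation.\<close>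

lemma kdiff_cis: "kdiff k UNIV (\<lambda>t::real. c * cis t)"
proof (induction k arbitrary: c)
  case 0
  have "((\<lambda>t. c * cis t) has_derivative (\<lambda>v. v *\<^sub>R ((c * \<i>) * cis y))) (at y)" for y
    by (rule derivative_eq_intros refl)+ (simp add: fun_eq_iff algebra_simps)
  then show ?case
    unfolding kdiff_0 differentiable_def by blast
next
  case (Suc k)
  show ?case
  proof (rule kdiff_SucI_derivative[OF open_UNIV])
    fix y :: real
    show "((\<lambda>t. c * cis t) has_derivative (\<lambda>v. v *\<^sub>R ((c * \<i>) * cis y))) (at y)"
      by (rule derivative_eq_intros refl)+ (simp add: fun_eq_iff algebra_simps)
  next
    fix v :: real
    show "kdiff k UNIV (\<lambda>y. v *\<^sub>R ((c * \<i>) * cis y))"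
      by (intro kdiff_bounded_linear[OF bounded_linear_scaleR_right] Suc open_UNIV)
  qed
qed


lemma smooth_on_open_iff:
  assumes "open S"
  shows "smooth_on S f \<longleftrightarrow> smooth_open S f"
proof
  assume f: "smooth_on S f"
  show "smooth_open S f"
    unfolding smooth_open_def
  proof (intro allI ballI)
    fix vs x assume "x \<in> S"
    then obtain W F where W: "open W" "x \<in> W" "smooth_open W F" "\<forall>y\<in>W \<inter> S. F y = f y"
      using f unfolding smooth_on_iff by blast
    have o: "open (W \<inter> S)" and x: "x \<in> W \<inter> S" using W assms \<open>x \<in> S\<close> by auto
    show "iter_deriv vs f differentiable (at x)"
    proof (rule differentiable_cong_open[OF o x])
      show "iter_deriv vs F y = iter_deriv vs f y" if "y \<in> W \<inter> S" for y
        using W(4) by (intro iter_deriv_cong_open[OF o that]) auto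
      show "iter_deriv vs F differentiable (at x)"
        using W(2,3) by (auto simp: smooth_open_def)
    qed
  qed
next
  assume "smooth_open S f"
  then show "smooth_on S f" using assms unfolding smooth_on_iff by blast
qed

lemma smooth_open_kdiff: "smooth_open W F \<Longrightarrow> V \<subseteq> W \<Longrightarrow> kdiff k V F"
  using kdiff_subset smooth_open_iff_kdiff by blast

lemma smooth_on_UNIV_kdiffI:
  assumes "\<And>k. kdiff k UNIV f"
  shows "smooth_on S f"
  unfolding smooth_on_iff smooth_open_iff_kdiff
  using assms by (intro ballI exI[of _ UNIV] exI[of _ f]) auto

lemma smooth_on_subset_cong:
  assumes "smooth_on S f" "T \<subseteq> S" "\<And>x. x \<in> T \<Longrightarrow> f x = g x"
  shows "smooth_on T g"
  unfolding smooth_on_iff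
proof
  fix x assume "x \<in> T"
  then obtain W F where "open W" "x \<in> W" "smooth_open W F" "\<forall>y\<in>W \<inter> S. F y = f y"
    using assms(1,2) unfolding smooth_on_iff by blast
  then show "\<exists>W F. open W \<and> x \<in> W \<and> smooth_open W F \<and> (\<forall>y\<in>W \<inter> T. F y = g y)"
    using assms(2,3) by (intro exI[of _ W] exI[of _ F]) auto
qed

lemmas smooth_on_subset = smooth_on_subset_cong[OF _ _ refl]
lemmas smooth_on_cong = smooth_on_subset_cong[OF _ order_refl]

text \<open>A local extension near a point only has to agree with the function near that point.\<close>

lemma smooth_on_local:
  assumes "\<And>x. x \<in> S \<Longrightarrow> \<exists>U. openin (top_of_set S) U \<and> x \<in> U \<and> smooth_on U f"
  shows "smooth_on S f"
  unfolding smooth_on_iff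
proof
  fix x assume "x \<in> S"
  then obtain O' where O': "open O'" "x \<in> O'" "smooth_on (S \<inter> O') f"
    using assms[OF \<open>x \<in> S\<close>] by (auto simp: openin_open)
  then obtain W F where "open W" "x \<in> W" "smooth_open W F" "\<forall>y\<in>W \<inter> (S \<inter> O'). F y = f y"
    using \<open>x \<in> S\<close> unfolding smooth_on_iff by (meson IntI)
  then show "\<exists>W F. open W \<and> x \<in> W \<and> smooth_open W F \<and> (\<forall>y\<in>W \<inter> S. F y = f y)"
    using O' by (intro exI[of _ "W \<inter> O'"] exI[of _ F]) (auto simp: smooth_open_def)
qed

lemma smooth_open_continuous_on: "smooth_open W F \<Longrightarrow> continuous_on W F"
  unfolding smooth_open_def
  by (metis continuous_at_imp_continuous_on differentiable_imp_continuous_within iter_deriv.simps(1))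

lemma smooth_on_continuous_on:
  assumes "smooth_on S f"
  shows "continuous_on S f"
proof (rule continuous_on_eq_continuous_within[THEN iffD2], rule ballI)
  fix x assume x: "x \<in> S"
  then obtain W F where W: "open W" "x \<in> W" "smooth_open W F" "\<forall>y\<in>W \<inter> S. F y = f y"
    using assms unfolding smooth_on_iff by blast
  have "(F \<longlongrightarrow> F x) (at x within S)"
    using smooth_open_continuous_on[OF W(3)] W(1,2)
    by (metis continuous_on_eq_continuous_at isCont_def tendsto_within_subset subset_UNIV)
  moreover have "\<forall>\<^sub>F y in at x within S. F y = f y"
    using W eventually_at_topological by fastforce
  ultimately have "(f \<longlongrightarrow> F x) (at x within S)"
    by (metis (mono_tags, lifting) tendsto_cong)
  then show "continuous (at x within S) f"
    using W x by (simp add: continuous_within)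
qed

lemma smooth_on_compose:
  fixes f :: "'a::real_normed_vector \<Rightarrow> 'b::euclidean_space" and g :: "'b \<Rightarrow> 'c::real_normed_vector"
  assumes "smooth_on S f" "smooth_on T g" "f ` S \<subseteq> T"
  shows "smooth_on S (\<lambda>x. g (f x))"
  unfolding smooth_on_iff
proof
  fix x assume "x \<in> S"
  obtain W F where W: "open W" "x \<in> W" "smooth_open W F" "\<forall>y\<in>W \<inter> S. F y = f y"
    using assms(1) \<open>x \<in> S\<close> unfolding smooth_on_iff by blast
  obtain V G where V: "open V" "f x \<in> V" "smooth_open V G" "\<forall>y\<in>V \<inter> T. G y = g y"
    using assms(2,3) \<open>x \<in> S\<close> unfolding smooth_on_iff by blast
  let ?N = "W \<inter> F -` V"
  have N: "open ?N"
    using continuous_open_preimage[OF smooth_open_continuous_on[OF W(3)] W(1) V(1)] .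
  have "smooth_open ?N (\<lambda>x. G (F x))"
    unfolding smooth_open_iff_kdiff
    using kdiff_compose[OF N V(1) _ smooth_open_kdiff[OF W(3)] smooth_open_kdiff[OF V(3) order_refl]]
    by auto
  moreover have "x \<in> ?N" using W V \<open>x \<in> S\<close> by auto
  moreover have "\<forall>y\<in>?N \<inter> S. G (F y) = g (f y)" using W V assms(3) by auto
  ultimately show "\<exists>W F. open W \<and> x \<in> W \<and> smooth_open W F \<and> (\<forall>y\<in>W \<inter> S. F y = g (f y))"
    using N by (intro exI[of _ ?N] exI[of _ "\<lambda>x. G (F x)"]) simp
qed

lemma smooth_on_bilinear:
  assumes "bounded_bilinear B" "smooth_on S f" "smooth_on S g"
  shows "smooth_on S (\<lambda>x. B (f x) (g x))"
  unfolding smooth_on_iff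
proof
  fix x assume "x \<in> S"
  then obtain W F W' G where W: "open W" "x \<in> W" "smooth_open W F" "\<forall>y\<in>W \<inter> S. F y = f y"
    and W': "open W'" "x \<in> W'" "smooth_open W' G" "\<forall>y\<in>W' \<inter> S. G y = g y"
    using assms(2,3) unfolding smooth_on_iff by metis
  have o: "open (W \<inter> W')" using W W' by auto
  have "smooth_open (W \<inter> W') (\<lambda>x. B (F x) (G x))"
    unfolding smooth_open_iff_kdiff
    using kdiff_bilinear[OF assms(1) o smooth_open_kdiff[OF W(3)] smooth_open_kdiff[OF W'(3)]]
    by auto
  then show "\<exists>W H. open W \<and> x \<in> W \<and> smooth_open W H \<and> (\<forall>y\<in>W \<inter> S. H y = B (f y) (g y))"
    using o W W' by (intro exI[of _ "W \<inter> W'"] exI[of _ "\<lambda>x. B (F x) (G x)"]) simp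
qed

lemma smooth_on_add:
  assumes "smooth_on S f" "smooth_on S g"
  shows "smooth_on S (\<lambda>x. f x + g x)"
  unfolding smooth_on_iff
proof
  fix x assume "x \<in> S"
  then obtain W F W' G where W: "open W" "x \<in> W" "smooth_open W F" "\<forall>y\<in>W \<inter> S. F y = f y"
    and W': "open W'" "x \<in> W'" "smooth_open W' G" "\<forall>y\<in>W' \<inter> S. G y = g y"
    using assms unfolding smooth_on_iff by metis
  have o: "open (W \<inter> W')" using W W' by auto
  have "smooth_open (W \<inter> W') (\<lambda>x. F x + G x)"
    unfolding smooth_open_iff_kdiff
    using kdiff_add[OF o smooth_open_kdiff[OF W(3)] smooth_open_kdiff[OF W'(3)]] by auto
  then show "\<exists>W H. open W \<and> x \<in> W \<and> smooth_open W H \<and> (\<forall>y\<in>W \<inter> S. H y = f y + g y)"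
    using o W W' by (intro exI[of _ "W \<inter> W'"] exI[of _ "\<lambda>x. F x + G x"]) simp
qed

lemma smooth_on_bounded_linear:
  assumes "bounded_linear L" "smooth_on S f"
  shows "smooth_on S (\<lambda>x. L (f x))"
  unfolding smooth_on_iff
proof
  fix x assume "x \<in> S"
  then obtain W F where W: "open W" "x \<in> W" "smooth_open W F" "\<forall>y\<in>W \<inter> S. F y = f y"
    using assms(2) unfolding smooth_on_iff by metis
  have "smooth_open W (\<lambda>x. L (F x))"
    unfolding smooth_open_iff_kdiff
    using kdiff_bounded_linear[OF assms(1) W(1) smooth_open_kdiff[OF W(3) order_refl]] by auto
  then show "\<exists>W H. open W \<and> x \<in> W \<and> smooth_open W H \<and> (\<forall>y\<in>W \<inter> S. H y = L (f y))"
    using W by (intro exI[of _ W] exI[of _ "\<lambda>x. L (F x)"]) simp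
qed

lemma smooth_on_const: "smooth_on S (\<lambda>x. c)"
  by (rule smooth_on_UNIV_kdiffI[OF kdiff_const])

lemma smooth_on_ident: "smooth_on S (\<lambda>x. x)"
  by (rule smooth_on_UNIV_kdiffI[OF kdiff_ident])

lemma smooth_on_linear: "bounded_linear L \<Longrightarrow> smooth_on S L"
  by (rule smooth_on_bounded_linear[OF _ smooth_on_ident])

lemma smooth_on_sum:
  "(\<And>i. i \<in> I \<Longrightarrow> smooth_on S (f i)) \<Longrightarrow> smooth_on S (\<lambda>x. \<Sum>i\<in>I. f i x)"
  by (induction I rule: infinite_finite_induct) (auto simp: smooth_on_const intro!: smooth_on_add)

lemma smooth_on_Pair:
  assumes "smooth_on S f" "smooth_on S g"
  shows "smooth_on S (\<lambda>x. (f x, g x))"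
proof -
  have "bounded_linear (\<lambda>x. (x, 0))" "bounded_linear (\<lambda>y. (0, y))"
    by (intro bounded_linear_Pair bounded_linear_ident bounded_linear_zero)+
  from smooth_on_add[OF smooth_on_bounded_linear[OF this(1) assms(1)]
      smooth_on_bounded_linear[OF this(2) assms(2)]]
  show ?thesis by simp
qed

lemma bounded_linear_axis: "bounded_linear (axis i :: 'b::real_normed_vector \<Rightarrow> 'b ^ 'i::finite)"
proof (rule bounded_linear_intro[where K = 1])
  have "norm (axis i x :: 'b ^ 'i) = sqrt (\<Sum>j\<in>UNIV. if j = i then (norm x)\<^sup>2 else 0)" for x
    unfolding norm_vec_def L2_set_def
    by (intro arg_cong[of _ _ sqrt] sum.cong) (auto simp: axis_def)
  then show "norm (axis i x :: 'b ^ 'i) \<le> norm x * 1" for x by simp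
qed (auto simp: vec_eq_iff axis_def)

lemma sum_axis: "(\<Sum>i\<in>UNIV. axis i (f i)) = (\<chi> i. f i)" for f :: "'i::finite \<Rightarrow> 'b::comm_monoid_add"
  by (simp add: vec_eq_iff axis_def sum.delta)

lemma has_vector_derivative_vec:
  fixes f :: "'i::finite \<Rightarrow> real \<Rightarrow> 'b::real_normed_vector"
  assumes "\<And>i. (f i has_vector_derivative d i) F"
  shows "((\<lambda>r. \<chi> i. f i r) has_vector_derivative (\<chi> i. d i)) F"
proof -
  have "((\<lambda>r. \<Sum>i\<in>UNIV. axis i (f i r)) has_vector_derivative (\<Sum>i\<in>UNIV. axis i (d i))) F"
    by (rule has_vector_derivative_sum)
      (rule bounded_linear.has_vector_derivative[OF bounded_linear_axis assms])
  then show ?thesis by (simp add: sum_axis)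
qed

lemma smooth_on_vec:
  fixes f :: "'i::finite \<Rightarrow> 'a::real_normed_vector \<Rightarrow> 'b::real_normed_vector"
  assumes "\<And>i. smooth_on S (f i)"
  shows "smooth_on S (\<lambda>x. \<chi> i. f i x)"
proof -
  have "smooth_on S (\<lambda>x. \<Sum>i\<in>UNIV. axis i (f i x))"
    by (rule smooth_on_sum) (rule smooth_on_bounded_linear[OF bounded_linear_axis assms])
  then show ?thesis by (simp add: sum_axis)
qed

lemma smooth_on_minus:
  "smooth_on S f \<Longrightarrow> smooth_on S (\<lambda>x. - f x)"
  by (rule smooth_on_bounded_linear[OF bounded_linear_minus[OF bounded_linear_ident]])

lemma smooth_on_diff:
  assumes "smooth_on S f" "smooth_on S g"
  shows "smooth_on S (\<lambda>x. f x - g x)"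
  using smooth_on_add[OF assms(1) smooth_on_minus[OF assms(2)]] by simp

lemma smooth_on_scaleR:
  "smooth_on S f \<Longrightarrow> smooth_on S g \<Longrightarrow> smooth_on S (\<lambda>x. f x *\<^sub>R g x)"
  by (rule smooth_on_bilinear[OF bounded_bilinear_scaleR])

lemma smooth_on_nth: "smooth_on S f \<Longrightarrow> smooth_on S (\<lambda>x. f x $ i)"
  by (rule smooth_on_bounded_linear[OF bounded_linear_vec_nth])

lemma smooth_on_mult:
  fixes f g :: "'a::real_normed_vector \<Rightarrow> 'b::real_normed_algebra"
  shows "smooth_on S f \<Longrightarrow> smooth_on S g \<Longrightarrow> smooth_on S (\<lambda>x. f x * g x)"
  by (rule smooth_on_bilinear[OF bounded_bilinear_mult])

lemma smooth_on_power:
  fixes f :: "'a::real_normed_vector \<Rightarrow> 'b::real_normed_algebra_1"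
  shows "smooth_on S f \<Longrightarrow> smooth_on S (\<lambda>x. f x ^ n)"
  by (induction n) (auto simp: smooth_on_const intro!: smooth_on_mult)

lemma smooth_on_cis: "smooth_on S cis"
  using kdiff_cis[of _ 1] by (auto intro: smooth_on_UNIV_kdiffI)

lemma smooth_on_cos: "smooth_on S (cos :: real \<Rightarrow> real)"
  using smooth_on_bounded_linear[OF bounded_linear_Re smooth_on_cis] by (simp add: o_def)

lemma smooth_on_sin: "smooth_on S (sin :: real \<Rightarrow> real)"
  using smooth_on_bounded_linear[OF bounded_linear_Im smooth_on_cis] by (simp add: o_def)

text \<open>The chain rule along curves holds even at points where the domain has no interior, through the
  derivative of a local extension.\<close>

lemma smooth_on_curve_differentiable:
  fixes \<gamma> :: "real \<Rightarrow> 'a::euclidean_space"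
  assumes "smooth_on S f" "(\<gamma> has_vector_derivative v) (at t within T)" "t \<in> T" "\<gamma> ` T \<subseteq> S"
  shows "\<exists>v'. ((\<lambda>r. f (\<gamma> r)) has_vector_derivative v') (at t within T)"
proof -
  obtain W F where W: "open W" "\<gamma> t \<in> W" "smooth_open W F" "\<forall>y\<in>W \<inter> S. F y = f y"
    using assms unfolding smooth_on_iff by blast
  have "F differentiable (at (\<gamma> t))"
    using W(2,3) unfolding smooth_open_def by (metis iter_deriv.simps(1))
  then obtain D where D: "(F has_derivative D) (at (\<gamma> t))" by (auto simp: differentiable_def)
  interpret D: bounded_linear D using D by (rule has_derivative_bounded_linear)
  have c: "((\<lambda>r. F (\<gamma> r)) has_vector_derivative D v) (at t within T)"
    using diff_chain_within[OF assms(2)[unfolded has_vector_derivative_def]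
        has_derivative_at_withinI[OF D]]
    by (simp add: has_vector_derivative_def o_def D.scaleR)
  have "continuous (at t within T) \<gamma>"
    using assms(2) has_vector_derivative_continuous by blast
  then have "\<forall>\<^sub>F r in at t within T. \<gamma> r \<in> W"
    using W(1,2) unfolding continuous_within by (simp add: topological_tendstoD)
  moreover have "\<forall>\<^sub>F r in at t within T. r \<in> T" by (simp add: eventually_at_filter)
  ultimately have "\<forall>\<^sub>F r in at t within T. F (\<gamma> r) = f (\<gamma> r)"
    by eventually_elim (use W(4) assms(4) in auto)
  with c have "((\<lambda>r. f (\<gamma> r)) has_vector_derivative D v) (at t within T)"
    unfolding has_vector_derivative_def
    by (rule has_derivative_transform_eventually) (use W assms in auto)
  then show ?thesis by blast
qed

section \<open>Maps induced on quotients\<close>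

definition reduced_manifold ::
  "'v::euclidean_space set \<Rightarrow> ('v \<times> 'v) set \<Rightarrow> ('v \<Rightarrow> 'v \<Rightarrow> real) \<Rightarrow> ('v set, 'e::euclidean_space) smanifold"
  where
  "reduced_manifold Z R \<omega> = \<lparr> pts = Z // R, atlas = quotient_atlas Z R, sform = reduced_form Z R \<omega> \<rparr>"

text \<open>The maps that carry whole classes onto classes, so that they act on the quotient by direct images.\<close>

definition descends :: "'v set \<Rightarrow> ('v \<times> 'v) set \<Rightarrow> ('v \<Rightarrow> 'v) \<Rightarrow> bool" where
  "descends Z R f \<longleftrightarrow> (\<forall>z\<in>Z. f z \<in> Z \<and> f ` (R `` {z}) = R `` {f z})"

definition induced_map :: "'v set \<Rightarrow> ('v \<times> 'v) set \<Rightarrow> ('v \<Rightarrow> 'v) \<Rightarrow> 'v set \<Rightarrow> 'v set" where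
  "induced_map Z R f = restrict (\<lambda>X. f ` X) (Z // R)"

lemma descends_in: "descends Z R f \<Longrightarrow> z \<in> Z \<Longrightarrow> f z \<in> Z"
  by (simp add: descends_def)

lemma induced_map_class: "descends Z R f \<Longrightarrow> z \<in> Z \<Longrightarrow> induced_map Z R f (R `` {z}) = R `` {f z}"
  by (simp add: descends_def induced_map_def quotientI)

lemma induced_map_funcset:
  assumes "descends Z R f"
  shows "induced_map Z R f \<in> Z // R \<rightarrow>\<^sub>E Z // R"
proof (rule PiE_I)
  fix X assume "X \<in> Z // R"
  then obtain z where "z \<in> Z" "X = R `` {z}" by (auto elim: quotientE)
  then show "induced_map Z R f X \<in> Z // R"
    using induced_map_class[OF assms] descends_in[OF assms] by (simp add: quotientI)
qed (simp add: induced_map_def)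

lemma induced_map_compose:
  assumes "descends Z R f" "descends Z R g"
  shows "induced_map Z R (\<lambda>z. f (g z)) = compose (Z // R) (induced_map Z R f) (induced_map Z R g)"
proof (rule ext)
  fix X
  have "g ` X \<in> Z // R" if "X \<in> Z // R"
    using induced_map_funcset[OF assms(2)] that by (auto simp: induced_map_def)
  then show "induced_map Z R (\<lambda>z. f (g z)) X = compose (Z // R) (induced_map Z R f) (induced_map Z R g) X"
    by (simp add: induced_map_def compose_def image_image)
qed

text \<open>Inverse charts lift locally to the total space. Everything about maps of the quotient in charts is
  reduced to maps of the total space through such lifts.\<close>

lemma quotient_atlas_section:
  assumes "(U, c) \<in> quotient_atlas Z R" "x \<in> c ` U"
  obtains V s where "open V" "x \<in> V" "V \<subseteq> c ` U" "smooth_on V s" "s ` V \<subseteq> Z"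
    "\<And>y. y \<in> V \<Longrightarrow> R `` {s y} = inv_into U c y"
    "\<And>y. y \<in> V \<Longrightarrow> R `` {s y} \<in> U" "\<And>y. y \<in> V \<Longrightarrow> c (R `` {s y}) = y"
proof -
  have "\<forall>x\<in>c ` U. \<exists>V s. open V \<and> x \<in> V \<and> V \<subseteq> c ` U \<and> smooth_on V s \<and> s ` V \<subseteq> Z \<and>
      (\<forall>y\<in>V. R `` {s y} = inv_into U c y)"
    using assms(1) by (simp only: quotient_atlas_def mem_Collect_eq prod.case) (elim conjE)
  then obtain V s where *: "open V" "x \<in> V" "V \<subseteq> c ` U" "smooth_on V s" "s ` V \<subseteq> Z"
    "\<forall>y\<in>V. R `` {s y} = inv_into U c y"
    using assms(2) by meson
  have "R `` {s y} \<in> U" "c (R `` {s y}) = y" if "y \<in> V" for y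
    using *(3,6) that inv_into_into[of y c U] f_inv_into_f[of y c U] by auto
  with * show ?thesis by (intro that[of V s]) auto
qed

lemma quotient_atlas_open: "(U, c) \<in> quotient_atlas Z R \<Longrightarrow> open (c ` U)"
  by (simp add: quotient_atlas_def)

lemma quotient_atlas_smooth:
  "(U, c) \<in> quotient_atlas Z R \<Longrightarrow> smooth_on {z \<in> Z. R `` {z} \<in> U} (\<lambda>z. c (R `` {z}))"
  by (simp add: quotient_atlas_def)

lemma quotient_atlas_openin:
  "(U, c) \<in> quotient_atlas Z R \<Longrightarrow> openin (top_of_set Z) {z \<in> Z. R `` {z} \<in> U}"
  by (simp add: quotient_atlas_def)

lemma smooth_on_family_section:
  fixes T :: "'t::euclidean_space set" and s :: "'e::euclidean_space \<Rightarrow> 'v::euclidean_space"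
    and A :: "'t \<Rightarrow> 'v \<Rightarrow> 'w::euclidean_space"
  assumes A: "smooth_on (T \<times> Z) (\<lambda>(t, z). A t z)" and s: "smooth_on W s" "s ` W \<subseteq> Z"
  shows "smooth_on (T \<times> W) (\<lambda>(t, y). A t (s y))"
proof -
  have fst: "smooth_on (T \<times> W) fst" and snd: "smooth_on (T \<times> W) snd"
    by (auto intro!: smooth_on_linear bounded_linear_fst bounded_linear_snd)
  have P: "smooth_on (T \<times> W) (\<lambda>p. (fst p, s (snd p)))"
    by (rule smooth_on_Pair[OF fst smooth_on_compose[OF snd s(1)]]) auto
  have "(\<lambda>p. (fst p, s (snd p))) ` (T \<times> W) \<subseteq> T \<times> Z" using s(2) by auto
  from smooth_on_compose[OF P A this] show ?thesis by (simp add: case_prod_beta')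
qed

text \<open>In charts the induced family is, near every point, the target chart after the projection, after
  the family upstairs, after a local lift of the inverse source chart; all of these are smooth.\<close>

theorem smooth_family_induced:
  fixes Z :: "'v::euclidean_space set" and T :: "'t::euclidean_space set"
  assumes A: "smooth_on (T \<times> Z) (\<lambda>(t, z). A t z)" and d: "\<And>t. t \<in> T \<Longrightarrow> descends Z R (A t)"
  shows "smooth_family (reduced_manifold Z R \<omega> :: ('v set, 'e::euclidean_space) smanifold) T
    (\<lambda>t. induced_map Z R (A t))"
proof -
  let ?f = "\<lambda>t. induced_map Z R (A t)"
  have "openin (top_of_set (T \<times> c ` U)) S \<and> smooth_on S (\<lambda>(t, x). c' (?f t (inv_into U c x)))"
    if C: "(U, c) \<in> quotient_atlas Z R" and C': "(U', c') \<in> quotient_atlas Z R"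
      and S: "S = {(t, x). t \<in> T \<and> x \<in> c ` U \<and> ?f t (inv_into U c x) \<in> U'}"
    for U U' S and c c' :: "'v set \<Rightarrow> 'e"
  proof -
    have loc: "\<exists>N. openin (top_of_set (T \<times> c ` U)) N \<and> p \<in> N \<and> N \<subseteq> S \<and>
        smooth_on N (\<lambda>(t, x). c' (?f t (inv_into U c x)))" if "p \<in> S" for p
    proof -
      obtain t0 x0 where p: "p = (t0, x0)" "t0 \<in> T" "x0 \<in> c ` U" using \<open>p \<in> S\<close> S by auto
      obtain W s where W: "open W" "x0 \<in> W" "W \<subseteq> c ` U" "smooth_on W s" "s ` W \<subseteq> Z"
        "\<And>y. y \<in> W \<Longrightarrow> R `` {s y} = inv_into U c y"
        by (rule quotient_atlas_section[OF C p(3)]) (rule that)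
      let ?G = "\<lambda>(t, y). A t (s y)"
      let ?Z' = "{z \<in> Z. R `` {z} \<in> U'}"
      have G: "smooth_on (T \<times> W) ?G" by (rule smooth_on_family_section[OF A W(4,5)])
      have fG: "?f t (inv_into U c y) = R `` {A t (s y)}" if "t \<in> T" "y \<in> W" for t y
        using induced_map_class[OF d[OF that(1)], of "s y"] W(5,6) that(2) by auto
      define N where "N = T \<times> W \<inter> ?G -` ?Z'"
      have AZ: "A t (s y) \<in> Z" if "t \<in> T" "y \<in> W" for t y
        using W(5) that by (auto intro!: descends_in[OF d])
      then have GZ: "?G \<in> T \<times> W \<rightarrow> Z" by auto
      have "openin (top_of_set (T \<times> W)) N"
        unfolding N_def
        by (rule continuous_openin_preimage[OF smooth_on_continuous_on[OF G] GZ quotient_atlas_openin[OF C']])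
      moreover have "openin (top_of_set (T \<times> c ` U)) (T \<times> W)"
        using W(1,3) by (auto simp: openin_open intro!: exI[of _ "UNIV \<times> W"] open_Times)
      ultimately have "openin (top_of_set (T \<times> c ` U)) N" by (rule openin_trans)
      moreover have "N \<subseteq> S" unfolding N_def S using fG W(3) by auto
      moreover have "p \<in> N" using \<open>p \<in> S\<close> AZ fG W(2) p unfolding N_def S by auto
      moreover have "smooth_on N (\<lambda>(t, x). c' (?f t (inv_into U c x)))"
      proof (rule smooth_on_cong)
        show "smooth_on N (\<lambda>q. c' (R `` {?G q}))"
          by (rule smooth_on_compose[OF smooth_on_subset[OF G] quotient_atlas_smooth[OF C']])
            (auto simp: N_def)
      qed (auto simp: N_def fG)
      ultimately show ?thesis by blast
    qed
    have o: "openin (top_of_set (T \<times> c ` U)) S"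
      by (subst openin_subopen) (use loc in blast)
    moreover have "smooth_on S (\<lambda>(t, x). c' (?f t (inv_into U c x)))"
    proof (rule smooth_on_local)
      fix p assume "p \<in> S"
      then obtain N where N: "openin (top_of_set (T \<times> c ` U)) N" "p \<in> N" "N \<subseteq> S"
        "smooth_on N (\<lambda>(t, x). c' (?f t (inv_into U c x)))" using loc by blast
      have "S \<subseteq> T \<times> c ` U" using S by auto
      then have "openin (top_of_set S) N" by (rule openin_subset_trans[OF N(1,3)])
      with N show "\<exists>N. openin (top_of_set S) N \<and> p \<in> N \<and>
          smooth_on N (\<lambda>(t, x). c' (?f t (inv_into U c x)))"
        by blast
    qed
    ultimately show ?thesis by blast
  qed
  then show ?thesis
    unfolding smooth_family_def reduced_manifold_def Let_def by auto
qed

text \<open>The slice of a relatively open set at one parameter is open, since chart images are.\<close>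

lemma smooth_family_imp_smooth_maps:
  fixes M :: "('p, 'e::euclidean_space) smanifold" and T :: "'t::euclidean_space set"
  assumes f: "smooth_family M T f" "t \<in> T" "f t \<in> pts M \<rightarrow>\<^sub>E pts M"
    and op: "\<And>U c. (U, c) \<in> atlas M \<Longrightarrow> open (c ` U)"
  shows "f t \<in> smooth_maps M"
proof -
  have "open {x \<in> c ` U. f t (inv_into U c x) \<in> V} \<and>
      smooth_on {x \<in> c ` U. f t (inv_into U c x) \<in> V} (\<lambda>x. d (f t (inv_into U c x)))"
    if "(U, c) \<in> atlas M" "(V, d) \<in> atlas M" for U c V d
  proof -
    let ?S = "{(t, x). t \<in> T \<and> x \<in> c ` U \<and> f t (inv_into U c x) \<in> V}"
    let ?S' = "{x \<in> c ` U. f t (inv_into U c x) \<in> V}"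
    have S: "openin (top_of_set (T \<times> c ` U)) ?S"
        "smooth_on ?S (\<lambda>(t, x). d (f t (inv_into U c x)))"
      using f(1) that unfolding smooth_family_def Let_def by fast+
    obtain O' where O': "open O'" "?S = (T \<times> c ` U) \<inter> O'" using S(1) by (auto simp: openin_open)
    have "?S' = c ` U \<inter> Pair t -` O'"
      using O'(2) f(2) by (auto simp: set_eq_iff)
    moreover have "open (Pair t -` O')" by (rule open_vimage[OF O'(1)]) (intro continuous_intros)
    ultimately have "open ?S'" using op[OF that(1)] by auto
    moreover have "smooth_on ?S' (\<lambda>x. d (f t (inv_into U c x)))"
    proof -
      have P: "smooth_on ?S' (\<lambda>x. (t, x))" by (rule smooth_on_Pair[OF smooth_on_const smooth_on_ident])
      have "(\<lambda>x. (t, x)) ` ?S' \<subseteq> ?S" using f(2) by auto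
      from smooth_on_compose[OF P S(2) this] show ?thesis by simp
    qed
    ultimately show ?thesis by blast
  qed
  then show ?thesis using f(3) unfolding smooth_maps_def Let_def by auto
qed


lemma smooth_fun_family_descended:
  fixes Z :: "'v::euclidean_space set" and T :: "'t::euclidean_space set"
  assumes h: "smooth_on Z h" and H: "\<And>z. z \<in> Z \<Longrightarrow> H (R `` {z}) = h z"
  shows "smooth_fun_family (reduced_manifold Z R \<omega> :: ('v set, 'e::euclidean_space) smanifold) T
    (\<lambda>_. H)"
proof -
  have "smooth_on (T \<times> c ` U) (\<lambda>(t, x). H (inv_into U c x))"
    if C: "(U, c) \<in> quotient_atlas Z R" for U and c :: "'v set \<Rightarrow> 'e"
  proof (rule smooth_on_local)
    fix p assume "p \<in> T \<times> c ` U"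
    then have p: "snd p \<in> c ` U" "fst p \<in> T" by auto
    obtain W s where W: "open W" "snd p \<in> W" "W \<subseteq> c ` U" "smooth_on W s" "s ` W \<subseteq> Z"
        "\<And>y. y \<in> W \<Longrightarrow> R `` {s y} = inv_into U c y"
      by (rule quotient_atlas_section[OF C p(1)]) (rule that)
    have "openin (top_of_set (T \<times> c ` U)) (T \<times> W)"
      using W(1,3) by (auto simp: openin_open intro!: exI[of _ "UNIV \<times> W"] open_Times)
    moreover have "smooth_on (T \<times> W) (\<lambda>(t, x). H (inv_into U c x))"
    proof (rule smooth_on_cong)
      have "smooth_on (T \<times> W) snd" by (rule smooth_on_linear[OF bounded_linear_snd])
      from smooth_on_compose[OF smooth_on_compose[OF this W(4)] h]
      show "smooth_on (T \<times> W) (\<lambda>q. h (s (snd q)))" using W(5) by fastforce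
      show "h (s (snd q)) = (case q of (t, x) \<Rightarrow> H (inv_into U c x))" if "q \<in> T \<times> W" for q
        using that W(5) by (auto simp flip: W(6) H)
    qed
    moreover have "p \<in> T \<times> W" using p W(2) by (cases p) auto
    ultimately show "\<exists>N. openin (top_of_set (T \<times> c ` U)) N \<and> p \<in> N \<and>
        smooth_on N (\<lambda>(t, x). H (inv_into U c x))" by blast
  qed
  then show ?thesis unfolding smooth_fun_family_def reduced_manifold_def by auto
qed

lemma induced_map_diffeo:
  fixes Z :: "'v::euclidean_space set"
  assumes f: "descends Z R f" "smooth_on Z f" and g: "descends Z R g" "smooth_on Z g"
    and fg: "\<And>z. z \<in> Z \<Longrightarrow> f (g z) = z" "\<And>z. z \<in> Z \<Longrightarrow> g (f z) = z"
  shows "induced_map Z R f \<in> diffeos (reduced_manifold Z R \<omega> :: ('v set, 'e::euclidean_space) smanifold)"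
proof -
  let ?M = "reduced_manifold Z R \<omega> :: ('v set, 'e) smanifold"
  have maps: "induced_map Z R k \<in> smooth_maps ?M" if k: "descends Z R k" "smooth_on Z k" for k
  proof -
    have "smooth_on ({0::real} \<times> Z) (\<lambda>(t, z). k z)"
    proof (rule smooth_on_cong)
      show "smooth_on ({0::real} \<times> Z) (\<lambda>q. k (snd q))"
        by (rule smooth_on_compose[OF smooth_on_linear[OF bounded_linear_snd] k(2)]) auto
    qed auto
    then have *: "smooth_family ?M {0::real} (\<lambda>t. induced_map Z R k)"
      using smooth_family_induced[where A = "\<lambda>t. k"] k(1) by blast
    show ?thesis
      by (rule smooth_family_imp_smooth_maps[OF *])
        (use induced_map_funcset[OF k(1)] in
          \<open>auto simp: reduced_manifold_def intro: quotient_atlas_open\<close>)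
  qed
  have inv: "induced_map Z R g (induced_map Z R f X) = X" "induced_map Z R f (induced_map Z R g X) = X"
    if "X \<in> Z // R" for X
    using that fg descends_in[OF f(1)] descends_in[OF g(1)]
    by (auto elim!: quotientE simp: induced_map_class[OF f(1)] induced_map_class[OF g(1)])
  have into: "induced_map Z R f X \<in> Z // R" "induced_map Z R g X \<in> Z // R" if "X \<in> Z // R" for X
    using induced_map_funcset[OF f(1)] induced_map_funcset[OF g(1)] that by auto
  have bij: "bij_betw (induced_map Z R f) (Z // R) (Z // R)"
    by (rule bij_betw_byWitness[where f' = "induced_map Z R g"]) (use inv into in auto)
  have "restrict (inv_into (Z // R) (induced_map Z R f)) (Z // R) = induced_map Z R g"
  proof (rule ext)
    fix X
    show "restrict (inv_into (Z // R) (induced_map Z R f)) (Z // R) X = induced_map Z R g X"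
    proof (cases "X \<in> Z // R")
      case True
      then show ?thesis
        using inv_into_f_eq[OF bij_betw_imp_inj_on[OF bij] into(2) inv(2)] by simp
    qed (simp add: induced_map_def)
  qed
  then show ?thesis
    using maps[OF f] maps[OF g] bij by (simp add: diffeos_def reduced_manifold_def)
qed

section \<open>The reduced form\<close>

text \<open>A smooth lift of the inverse chart that passes through a prescribed point \<open>z\<close> of the total space.\<close>

definition local_lift ::
  "'v::euclidean_space set \<Rightarrow> ('v \<times> 'v) set \<Rightarrow> 'v set set \<Rightarrow> ('v set \<Rightarrow> 'e::euclidean_space)
     \<Rightarrow> 'v \<Rightarrow> 'e set \<Rightarrow> ('e \<Rightarrow> 'v) \<Rightarrow> bool" where
  "local_lift Z R U c z V s \<longleftrightarrow>
     open V \<and> c (R `` {z}) \<in> V \<and> V \<subseteq> c ` U \<and> smooth_on V s \<and> s ` V \<subseteq> Z \<and>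
     (\<forall>y\<in>V. R `` {s y} = inv_into U c y) \<and> s (c (R `` {z})) = z"

lemma smooth_on_open_has_derivative:
  assumes "open V" "smooth_on V s" "x \<in> V"
  shows "(s has_derivative frechet_derivative s (at x)) (at x)"
  using assms smooth_on_open_iff[OF assms(1)] smooth_open_def
  by (metis frechet_derivative_works iter_deriv.simps(1))

lemma local_lift_has_derivative:
  "local_lift Z R U c z V s \<Longrightarrow>
    (s has_derivative frechet_derivative s (at (c (R `` {z})))) (at (c (R `` {z})))"
  unfolding local_lift_def by (blast intro: smooth_on_open_has_derivative)

lemma local_lift_chart:
  assumes "local_lift Z R U c z V s" "y \<in> V"
  shows "R `` {s y} \<in> U" "c (R `` {s y}) = y" "s y \<in> Z"
proof -
  have "y \<in> c ` U" "R `` {s y} = inv_into U c y" "s y \<in> Z"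
    using assms unfolding local_lift_def by auto
  then show "R `` {s y} \<in> U" "c (R `` {s y}) = y" "s y \<in> Z"
    by (auto simp: inv_into_into f_inv_into_f)
qed

text \<open>Lifting straight lines realises every coordinate vector as the velocity of the image of a smooth
  curve in the total space. Hence at most one bilinear form can satisfy the description of the reduced form.\<close>

lemma local_lift_curve:
  assumes l: "local_lift Z R U c z V s"
  defines "x \<equiv> c (R `` {z})"
  shows "smooth_curve_through Z z (\<lambda>r. s (x + r *\<^sub>R v))"
    and "((\<lambda>r. s (x + r *\<^sub>R v)) has_vector_derivative frechet_derivative s (at x) v) (at 0)"
    and "((\<lambda>r. c (R `` {s (x + r *\<^sub>R v)})) has_vector_derivative v) (at 0)"
proof -
  have V: "open V" "x \<in> V" "smooth_on V s" "s ` V \<subseteq> Z" "s x = z"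
    using l unfolding local_lift_def x_def by auto
  let ?l = "\<lambda>r. x + r *\<^sub>R v"
  have d: "(?l has_vector_derivative v) (at 0)"
    by (auto intro!: derivative_eq_intros)
  have "open (?l -` V)" by (rule open_vimage[OF V(1)]) (intro continuous_intros)
  then obtain e where e: "e > 0" "ball 0 e \<subseteq> ?l -` V"
    using openE[of "?l -` V" 0] V(2) by auto
  then have eV: "?l r \<in> V" if "r \<in> {-e<..<e}" for r
    using that by (auto simp: subset_iff dist_norm)
  have "smooth_on {-e<..<e} ?l"
    by (intro smooth_on_add[OF smooth_on_const] smooth_on_linear bounded_linear_scaleR_left)
  then have "smooth_on {-e<..<e} (\<lambda>r. s (?l r))"
    by (rule smooth_on_compose[OF _ V(3)]) (use eV in auto)
  then show "smooth_curve_through Z z (\<lambda>r. s (x + r *\<^sub>R v))"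
    unfolding smooth_curve_through_def using V(4,5) eV e(1) by (auto intro!: exI[of _ e])
  have "(s has_derivative frechet_derivative s (at x)) (at (?l 0))"
    using local_lift_has_derivative[OF l] by (simp add: x_def)
  from vector_derivative_diff_chain_within[OF d, of s "frechet_derivative s (at x)"]
  show "((\<lambda>r. s (x + r *\<^sub>R v)) has_vector_derivative frechet_derivative s (at x) v) (at 0)"
    using has_derivative_at_withinI[OF \<open>(s has_derivative _) (at (?l 0))\<close>] by (simp add: o_def)
  show "((\<lambda>r. c (R `` {s (x + r *\<^sub>R v)})) has_vector_derivative v) (at 0)"
  proof (rule has_vector_derivative_transform_within_open[OF d])
    show "?l r = c (R `` {s (x + r *\<^sub>R v)})" if "r \<in> {-e<..<e}" for r
      using local_lift_chart(2)[OF l eV[OF that]] by simp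
  qed (use e in auto)
qed

text \<open>What the existence of the reduced form needs. Equivalent points are related by a linear symplectic
  map that preserves all classes, and two curves that start at the same point and stay pointwise
  equivalent have velocities that differ by a vector in the kernel of the form on the level
  set. For a level set of the moment map of a free torus action, the velocities differ by an orbit
  direction, which is orthogonal to the level set with respect to the form.\<close>

locale symplectic_reduction =
  fixes Z :: "'v::euclidean_space set" and R :: "('v \<times> 'v) set" and \<omega> :: "'v \<Rightarrow> 'v \<Rightarrow> real"
  assumes equiv: "equiv Z R"
    and homogeneous: "(z, z') \<in> R \<Longrightarrow>
      \<exists>g. bounded_linear g \<and> g z = z' \<and> (\<forall>y\<in>Z. (y, g y) \<in> R) \<and> (\<forall>v w. \<omega> (g v) (g w) = \<omega> v w)"
    and antisym: "\<omega> v w = - \<omega> w v"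
    and orbit_null: "\<lbrakk>\<gamma> 0 = z; \<sigma> 0 = z; (\<gamma> has_vector_derivative v) (at 0);
      (\<sigma> has_vector_derivative v') (at 0); \<forall>\<^sub>F r in nhds 0. (\<gamma> r, \<sigma> r) \<in> R;
      smooth_curve_through Z z \<delta>; (\<delta> has_vector_derivative w) (at 0)\<rbrakk> \<Longrightarrow> \<omega> v w = \<omega> v' w"
begin

lemma class_eq: "(z, w) \<in> R \<Longrightarrow> R `` {z} = R `` {w}"
  using equiv by (rule equiv_class_eq)

lemma class_eqD: "R `` {z} = R `` {w} \<Longrightarrow> w \<in> Z \<Longrightarrow> (z, w) \<in> R"
  using eq_equiv_class[OF _ equiv] by blast

lemma related_in: "(z, w) \<in> R \<Longrightarrow> z \<in> Z \<and> w \<in> Z"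
  using equiv by (auto simp: equiv_def)

lemma local_lift_translate:
  assumes l: "local_lift Z R U c z V s" and g: "bounded_linear g" "\<And>y. y \<in> Z \<Longrightarrow> (y, g y) \<in> R"
    and z: "z \<in> Z"
  shows "local_lift Z R U c (g z) V (\<lambda>y. g (s y))"
  unfolding local_lift_def
proof (intro conjI ballI)
  have sZ: "s y \<in> Z" if "y \<in> V" for y using l that by (auto simp: local_lift_def)
  have z': "R `` {g z} = R `` {z}" using class_eq[OF g(2)[OF z]] by simp
  show "(\<lambda>y. g (s y)) ` V \<subseteq> Z" using g(2)[OF sZ] related_in by blast
  show "R `` {g (s y)} = inv_into U c y" if "y \<in> V" for y
    using class_eq[OF g(2)[OF sZ[OF that]]] l that by (simp add: local_lift_def)
  show "smooth_on V (\<lambda>y. g (s y))"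
    using l by (intro smooth_on_bounded_linear[OF g(1)]) (simp add: local_lift_def)
  show "g (s (c (R `` {g z}))) = g z" "c (R `` {g z}) \<in> V"
    using l unfolding local_lift_def z' by auto
qed (use l in \<open>simp_all add: local_lift_def\<close>)

lemma local_lift_exists:
  assumes C: "(U, c) \<in> quotient_atlas Z R" and z: "z \<in> Z" "R `` {z} \<in> U"
  obtains V s where "local_lift Z R U c z V s"
proof -
  let ?x = "c (R `` {z})"
  obtain V s where V: "open V" "?x \<in> V" "V \<subseteq> c ` U" "smooth_on V s" "s ` V \<subseteq> Z"
      "\<And>y. y \<in> V \<Longrightarrow> R `` {s y} = inv_into U c y"
    by (rule quotient_atlas_section[OF C imageI[OF z(2)]]) (rule that)
  have "inj_on c U" using C by (simp add: quotient_atlas_def)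
  then have sx: "R `` {s ?x} = R `` {z}" using V(2,6) z(2) by simp
  then have "local_lift Z R U c (s ?x) V s" using V by (auto simp: local_lift_def)
  moreover obtain g where "bounded_linear g" "g (s ?x) = z" "\<forall>y\<in>Z. (y, g y) \<in> R"
    using homogeneous[OF class_eqD[OF sx z(1)]] by blast
  moreover have "s ?x \<in> Z" using V by auto
  ultimately have "local_lift Z R U c z V (\<lambda>y. g (s y))"
    using local_lift_translate[of U c "s ?x" V s g] by auto
  then show ?thesis by (rule that)
qed

text \<open>A curve and the lift of its image have the same starting point and are pointwise equivalent, so
  the form cannot distinguish their velocities. In particular \<open>\<omega>\<close> sees only the image of the velocity.\<close>

lemma curve_via_lift:
  assumes C: "(U, c) \<in> quotient_atlas Z R" and z: "z \<in> Z" "R `` {z} \<in> U"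
    and l: "local_lift Z R U c z V s"
    and \<gamma>: "smooth_curve_through Z z \<gamma>" "(\<gamma> has_vector_derivative v) (at 0)"
      "((\<lambda>r. c (R `` {\<gamma> r})) has_vector_derivative v') (at 0)"
    and \<delta>: "smooth_curve_through Z z \<delta>" "(\<delta> has_vector_derivative w) (at 0)"
  shows "\<omega> v w = \<omega> (frechet_derivative s (at (c (R `` {z}))) v') w"
proof -
  let ?x = "c (R `` {z})"
  let ?k = "\<lambda>r. c (R `` {\<gamma> r})"
  have V: "open V" "?x \<in> V" "s ?x = z" "\<And>y. y \<in> V \<Longrightarrow> R `` {s y} = inv_into U c y" "s ` V \<subseteq> Z"
    using l by (auto simp: local_lift_def)
  have inj: "inj_on c U" using C by (simp add: quotient_atlas_def)
  obtain e where e: "\<gamma> 0 = z" "e > 0" "\<gamma> ` {-e<..<e} \<subseteq> Z"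
    using \<gamma>(1) by (auto simp: smooth_curve_through_def)
  \<comment> \<open>Near time zero the curve stays over the chart domain and its image stays where the lift is
    defined, so there the curve and the lift of its image lie in the same classes.\<close>
  have ev0: "\<forall>\<^sub>F r in nhds 0. r \<in> {-e<..<e}"
    using e(2) by (intro eventually_nhds_in_open) auto
  obtain N where N: "open N" "{z \<in> Z. R `` {z} \<in> U} = Z \<inter> N"
    using quotient_atlas_openin[OF C] by (auto simp: openin_open)
  have lim: "(\<gamma> \<longlongrightarrow> \<gamma> 0) (nhds 0)" "(?k \<longlongrightarrow> ?k 0) (nhds 0)"
    using has_vector_derivative_continuous[OF \<gamma>(2)] has_vector_derivative_continuous[OF \<gamma>(3)]
    by (simp_all add: continuous_at tendsto_nhds_iff isCont_def flip: tendsto_at_iff_tendsto_nhds)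
  have ev1: "\<forall>\<^sub>F r in nhds 0. \<gamma> r \<in> N"
    using topological_tendstoD[OF lim(1) N(1)] z N(2) e(1) by auto
  have ev2: "\<forall>\<^sub>F r in nhds 0. ?k r \<in> V"
    using topological_tendstoD[OF lim(2) V(1)] V(2) e(1) by auto
  have ev: "\<forall>\<^sub>F r in nhds 0. (\<gamma> r, s (?k r)) \<in> R"
    using ev0 ev1 ev2
  proof eventually_elim
    case (elim r)
    then have "\<gamma> r \<in> Z \<inter> N" using e(3) by auto
    then have U: "R `` {\<gamma> r} \<in> U" unfolding N(2)[symmetric] by simp
    have "R `` {\<gamma> r} = R `` {s (?k r)}"
      using V(4)[OF elim(3)] inv_into_f_f[OF inj U] by simp
    moreover have "s (?k r) \<in> Z" using V(5) elim(3) by auto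
    ultimately show ?case by (rule class_eqD)
  qed
  have "(s has_derivative frechet_derivative s (at ?x)) (at (?k 0))"
    using local_lift_has_derivative[OF l] e(1) by simp
  from vector_derivative_diff_chain_within[OF \<gamma>(3) has_derivative_at_withinI[OF this]]
  have "((\<lambda>r. s (?k r)) has_vector_derivative frechet_derivative s (at ?x) v') (at 0)"
    by (simp add: o_def)
  then show ?thesis
    by (intro orbit_null[OF e(1) _ \<gamma>(2) _ ev \<delta>]) (simp_all add: e(1) V(3))
qed

lemma form_via_lift:
  assumes C: "(U, c) \<in> quotient_atlas Z R" and z: "z \<in> Z" "R `` {z} \<in> U"
    and l: "local_lift Z R U c z V s"
    and \<gamma>: "smooth_curve_through Z z \<gamma>" "(\<gamma> has_vector_derivative v) (at 0)"
      "((\<lambda>r. c (R `` {\<gamma> r})) has_vector_derivative v') (at 0)"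
    and \<delta>: "smooth_curve_through Z z \<delta>" "(\<delta> has_vector_derivative w) (at 0)"
      "((\<lambda>r. c (R `` {\<delta> r})) has_vector_derivative w') (at 0)"
  defines "D \<equiv> frechet_derivative s (at (c (R `` {z})))"
  shows "\<omega> v w = \<omega> (D v') (D w')"
proof -
  have "\<omega> v w = \<omega> (D v') w"
    unfolding D_def by (rule curve_via_lift[OF C z l \<gamma> \<delta>(1,2)])
  also have "\<dots> = - \<omega> w (D v')" by (rule antisym)
  also have "\<omega> w (D v') = \<omega> (D w') (D v')"
    unfolding D_def by (rule curve_via_lift[OF C z l \<delta> local_lift_curve(1,2)[OF l]])
  also have "- \<dots> = \<omega> (D v') (D w')" by (rule antisym[symmetric])
  finally show ?thesis .
qed

text \<open>The description by curves defines a form: existence follows by moving a lift from one point of a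
  class to another with a symplectic map, uniqueness because every vector is a velocity.\<close>

lemma reduced_form_eq:
  assumes C: "(U, c) \<in> quotient_atlas Z R" and z: "z \<in> Z" "R `` {z} \<in> U"
    and l: "local_lift Z R U c z V s"
  defines "D \<equiv> frechet_derivative s (at (c (R `` {z})))"
  shows "reduced_form Z R \<omega> (U, c) (c (R `` {z})) = (\<lambda>v' w'. \<omega> (D v') (D w'))"
proof -
  let ?x = "c (R `` {z})"
  define P where "P B \<longleftrightarrow> (\<forall>z1 \<gamma> \<delta> v w v' w'.
         z1 \<in> Z \<and> R `` {z1} \<in> U \<and> c (R `` {z1}) = ?x \<and>
         smooth_curve_through Z z1 \<gamma> \<and> smooth_curve_through Z z1 \<delta> \<and>
         (\<gamma> has_vector_derivative v) (at 0) \<and> (\<delta> has_vector_derivative w) (at 0) \<and>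
         ((\<lambda>r. c (R `` {\<gamma> r})) has_vector_derivative v') (at 0) \<and>
         ((\<lambda>r. c (R `` {\<delta> r})) has_vector_derivative w') (at 0)
         \<longrightarrow> B v' w' = \<omega> v w)" for B
  have inj: "inj_on c U" using C by (simp add: quotient_atlas_def)
  have "P (\<lambda>v' w'. \<omega> (D v') (D w'))"
    unfolding P_def
  proof (intro allI impI, elim conjE)
    fix z1 \<gamma> \<delta> v w v' w'
    assume z1: "z1 \<in> Z" "R `` {z1} \<in> U" "c (R `` {z1}) = ?x"
      and \<gamma>: "smooth_curve_through Z z1 \<gamma>" and \<delta>: "smooth_curve_through Z z1 \<delta>"
      and \<gamma>2: "(\<gamma> has_vector_derivative v) (at 0)" and \<delta>2: "(\<delta> has_vector_derivative w) (at 0)"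
      and \<gamma>3: "((\<lambda>r. c (R `` {\<gamma> r})) has_vector_derivative v') (at 0)"
      and \<delta>3: "((\<lambda>r. c (R `` {\<delta> r})) has_vector_derivative w') (at 0)"
    have "R `` {z} = R `` {z1}" using inj_onD[OF inj z1(3)] z1(2) z(2) by simp
    then obtain g where g: "bounded_linear g" "g z = z1" "\<forall>y\<in>Z. (y, g y) \<in> R"
      "\<And>v w. \<omega> (g v) (g w) = \<omega> v w"
      using homogeneous[OF class_eqD] z1(1) by blast
    have l1: "local_lift Z R U c z1 V (\<lambda>y. g (s y))"
      using local_lift_translate[OF l g(1) _ z(1)] g(2,3) by auto
    have "((\<lambda>y. g (s y)) has_derivative (\<lambda>v. g (D v))) (at ?x)"
      unfolding D_def by (rule bounded_linear.has_derivative[OF g(1) local_lift_has_derivative[OF l]])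
    then have gD: "frechet_derivative (\<lambda>y. g (s y)) (at ?x) = (\<lambda>v. g (D v))"
      by (metis frechet_derivative_at)
    show "\<omega> (D v') (D w') = \<omega> v w"
      using form_via_lift[OF C z1(1,2) l1 \<gamma> \<gamma>2 \<gamma>3 \<delta> \<delta>2 \<delta>3] unfolding z1(3) gD g(4) by simp
  qed
  moreover have "B = (\<lambda>v' w'. \<omega> (D v') (D w'))" if "P B" for B
  proof (intro ext)
    fix v' w'
    show "B v' w' = \<omega> (D v') (D w')"
      using that[unfolded P_def, rule_format, OF conjI[OF z(1) conjI[OF z(2) conjI[OF refl
        conjI[OF local_lift_curve(1)[OF l] conjI[OF local_lift_curve(1)[OF l]
        conjI[OF local_lift_curve(2)[OF l] conjI[OF local_lift_curve(2)[OF l]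
        conjI[OF local_lift_curve(3)[OF l] local_lift_curve(3)[OF l]]]]]]]]]]
      unfolding D_def .
  qed
  ultimately have "(THE B. P B) = (\<lambda>v' w'. \<omega> (D v') (D w'))" by (rule the_equality)
  then show ?thesis unfolding reduced_form_def P_def by simp
qed

end

section \<open>Hamiltonian isotopies of the quotient\<close>

definition descended_fun :: "('v \<Rightarrow> real) \<Rightarrow> 'v set \<Rightarrow> real" where
  "descended_fun h X = h (SOME z. z \<in> X)"

context symplectic_reduction
begin

lemma descended_fun_class:
  assumes "\<And>z w. (z, w) \<in> R \<Longrightarrow> h z = h w" "z \<in> Z"
  shows "descended_fun h (R `` {z}) = h z"
proof -
  have "(z, z) \<in> R" using equiv assms(2) by (auto simp: equiv_def refl_on_def)
  then have "(SOME w. w \<in> R `` {z}) \<in> R `` {z}" by (metis ImageI insertI1 someI)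
  then have "(z, SOME w. w \<in> R `` {z}) \<in> R" by simp
  from assms(1)[OF this] show ?thesis by (simp add: descended_fun_def)
qed

text \<open>A one-parameter group upstairs with Hamiltonian \<open>h\<close>, both compatible with the equivalence relation,
  induces a Hamiltonian isotopy of the quotient. Hamilton's equation is checked on lifted straight
  lines, where the reduced form is \<open>\<omega>\<close> and the descended function is \<open>h\<close>.\<close>

theorem ham_isotopy_induced:
  fixes A :: "real \<Rightarrow> 'v \<Rightarrow> 'v"
  assumes smooth: "smooth_on UNIV (\<lambda>(t, z). A t z)"
    and desc: "\<And>t. descends Z R (A t)"
    and group: "\<And>s t z. A (s + t) z = A s (A t z)" "\<And>z. A 0 z = z"
    and gen: "\<And>z. ((\<lambda>r. A r z) has_vector_derivative \<xi> z) (at 0)"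
    and h: "smooth_on UNIV h" "\<And>z w. (z, w) \<in> R \<Longrightarrow> h z = h w"
    and dh: "\<And>z. (h has_derivative (\<lambda>w. - \<omega> (\<xi> z) w)) (at z)"
  shows "ham_isotopy (reduced_manifold Z R \<omega> :: ('v set, 'e::euclidean_space) smanifold)
    (\<lambda>_. descended_fun h) (\<lambda>t. induced_map Z R (A t))"
  unfolding ham_isotopy_def
proof (intro conjI ballI)
  let ?M = "reduced_manifold Z R \<omega> :: ('v set, 'e) smanifold"
  let ?\<Phi> = "\<lambda>t. induced_map Z R (A t)"
  let ?H = "descended_fun h"
  have sA: "smooth_on S (\<lambda>(t, z). A t z)" for S by (rule smooth_on_subset[OF smooth]) simp
  have H: "?H (R `` {z}) = h z" if "z \<in> Z" for z by (rule descended_fun_class[OF h(2) that])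
  show "smooth_fun_family ?M {0..1::real} (\<lambda>_. ?H)"
    by (rule smooth_fun_family_descended[OF smooth_on_subset[OF h(1)] H]) auto
  show "smooth_family ?M {0..1} ?\<Phi>"
    by (rule smooth_family_induced[OF sA desc])
  have At: "smooth_on S (A t)" for S t
  proof -
    have "smooth_on S (\<lambda>z. (t, z))" by (rule smooth_on_Pair[OF smooth_on_const smooth_on_ident])
    from smooth_on_compose[OF this smooth] show ?thesis by simp
  qed
  show "?\<Phi> t \<in> diffeos ?M" for t
    by (rule induced_map_diffeo[OF desc At desc At, of _ "- t"])
      (simp_all add: group(2) flip: group(1))
  show "?\<Phi> 0 p = p" if "p \<in> pts ?M" for p
    using that desc[of 0]
    by (auto simp: reduced_manifold_def group(2) induced_map_def)
  show "case C of (U, c) \<Rightarrow> \<forall>t\<in>{0..1}. \<forall>p\<in>pts ?M. ?\<Phi> t p \<in> U \<longrightarrow>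
        (\<exists>X. ((\<lambda>r. c (?\<Phi> r p)) has_vector_derivative X) (at t within {0..1}) \<and>
             (\<forall>w. sform ?M (U, c) (c (?\<Phi> t p)) X w =
                - frechet_derivative (\<lambda>x. ?H (inv_into U c x)) (at (c (?\<Phi> t p))) w))"
    if "C \<in> atlas ?M" for C
  proof (clarify)
    fix U c t p assume C': "C = (U, c)" and p: "p \<in> pts ?M" "?\<Phi> t p \<in> U"
    have C: "(U, c) \<in> quotient_atlas Z R" using that C' by (simp add: reduced_manifold_def)
    obtain z0 where z0: "z0 \<in> Z" "p = R `` {z0}"
      using p(1) by (auto simp: reduced_manifold_def elim: quotientE)
    define z where "z = A t z0"
    have AZ: "A r y \<in> Z" if "y \<in> Z" for r y using descends_in[OF desc that] .
    have \<Phi>: "?\<Phi> r p = R `` {A r z0}" for r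
      using induced_map_class[OF desc z0(1)] z0(2) by simp
    have z: "z \<in> Z" "R `` {z} \<in> U" "?\<Phi> t p = R `` {z}"
      using AZ[OF z0(1)] \<Phi> p(2) by (auto simp: z_def)
    obtain V s where l: "local_lift Z R U c z V s"
      using local_lift_exists[OF C z(1,2)] by blast
    let ?x = "c (R `` {z})"
    define D where "D = frechet_derivative s (at ?x)"
    let ?Z' = "{z \<in> Z. R `` {z} \<in> U}"
    let ?\<gamma> = "\<lambda>r. A r z"
    have s\<gamma>: "smooth_on S ?\<gamma>" for S
    proof -
      have "smooth_on S (\<lambda>r. (r, z))" by (rule smooth_on_Pair[OF smooth_on_ident smooth_on_const])
      from smooth_on_compose[OF this smooth] show ?thesis by simp
    qed
    have \<gamma>: "smooth_curve_through Z z ?\<gamma>"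
      unfolding smooth_curve_through_def using s\<gamma> AZ[OF z(1)]
      by (auto simp: group(2) intro!: exI[of _ 1])
    obtain N where N: "open N" "?Z' = Z \<inter> N"
      using quotient_atlas_openin[OF C] by (auto simp: openin_open)
    have T: "open (?\<gamma> -` N)"
      by (rule open_vimage[OF N(1) smooth_on_continuous_on[OF s\<gamma>]])
    have 0: "0 \<in> ?\<gamma> -` N" using N(2) z by (auto simp: group(2))
    have im: "?\<gamma> ` (?\<gamma> -` N) \<subseteq> ?Z'" unfolding N(2) using AZ[OF z(1)] by auto
    obtain X where "((\<lambda>r. c (R `` {?\<gamma> r})) has_vector_derivative X) (at 0 within ?\<gamma> -` N)"
      using smooth_on_curve_differentiable[OF quotient_atlas_smooth[OF C]
          has_vector_derivative_at_within[OF gen] 0 im] by blast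
    then have X: "((\<lambda>r. c (R `` {?\<gamma> r})) has_vector_derivative X) (at 0)"
      using has_vector_derivative_within_open[OF 0 T] by blast
    \<comment> \<open>By the group law the isotopy at time \<open>r\<close> is the curve through \<open>z\<close> at time \<open>r - t\<close>.\<close>
    have "((\<lambda>r. r - t) has_vector_derivative 1) (at t)"
      by (auto intro!: derivative_eq_intros)
    from vector_diff_chain_at[OF this, of "\<lambda>r. c (R `` {?\<gamma> r})" X] X
    have "((\<lambda>r. c (R `` {?\<gamma> (r - t)})) has_vector_derivative X) (at t)"
      by (simp add: o_def)
    moreover have "?\<gamma> (r - t) = A r z0" for r
      unfolding z_def by (simp flip: group(1))
    ultimately have Xt: "((\<lambda>r. c (?\<Phi> r p)) has_vector_derivative X) (at t within {0..1})"
      unfolding \<Phi> by (simp add: has_vector_derivative_at_within)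
    have "sform ?M (U, c) (c (?\<Phi> t p)) X w =
        - frechet_derivative (\<lambda>x. ?H (inv_into U c x)) (at (c (?\<Phi> t p))) w" for w
    proof -
      have "sform ?M (U, c) (c (?\<Phi> t p)) X w = \<omega> (D X) (D w)"
        unfolding z(3) using reduced_form_eq[OF C z(1,2) l] by (simp add: reduced_manifold_def D_def)
      also have "\<dots> = \<omega> (\<xi> z) (D w)"
        unfolding D_def
        by (rule curve_via_lift[OF C z(1,2) l \<gamma> gen X local_lift_curve(1,2)[OF l], symmetric])
      finally have 1: "sform ?M (U, c) (c (?\<Phi> t p)) X w = \<omega> (\<xi> z) (D w)" .
      have V: "open V" "?x \<in> V" "s ?x = z" using l by (auto simp: local_lift_def)
      have "(h has_derivative (\<lambda>w. - \<omega> (\<xi> z) w)) (at (s ?x))" using dh V(3) by simp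
      from diff_chain_at[OF local_lift_has_derivative[OF l] this]
      have "((\<lambda>y. h (s y)) has_derivative (\<lambda>w. - \<omega> (\<xi> z) (D w))) (at ?x)"
        by (simp add: o_def D_def)
      then have "((\<lambda>x. ?H (inv_into U c x)) has_derivative (\<lambda>w. - \<omega> (\<xi> z) (D w))) (at ?x)"
      proof (rule has_derivative_transform_within_open[OF _ V(1,2)])
        show "h (s y) = ?H (inv_into U c y)" if "y \<in> V" for y
          using H[OF local_lift_chart(3)[OF l that]] l that by (simp add: local_lift_def)
      qed
      from frechet_derivative_at[OF this]
      have "frechet_derivative (\<lambda>x. ?H (inv_into U c x)) (at ?x) w = - \<omega> (\<xi> z) (D w)"
        by (metis (no_types))
      with 1 show ?thesis unfolding z(3) by simp
    qed
    with Xt show "\<exists>X. ((\<lambda>r. c (?\<Phi> r p)) has_vector_derivative X) (at t within {0..1}) \<and>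
             (\<forall>w. sform ?M (U, c) (c (?\<Phi> t p)) X w =
                - frechet_derivative (\<lambda>x. ?H (inv_into U c x)) (at (c (?\<Phi> t p))) w)"
      by blast
  qed
qed

end

section \<open>Smooth families and the smooth topology on maps\<close>

text \<open>Derivatives at a fixed parameter are derivatives of the whole family in directions tangent to the
  slice. They are therefore continuous in the parameter as well.\<close>

lemma iter_deriv_slice:
  fixes F :: "'t::real_normed_vector \<times> 'e::real_normed_vector \<Rightarrow> 'b::real_normed_vector"
  assumes W: "open W" and F: "smooth_open W F" and p: "(t, y) \<in> W"
  shows "iter_deriv vs (\<lambda>y. F (t, y)) y = iter_deriv (map (Pair 0) vs) F (t, y)"
  using F
proof (induction vs arbitrary: F)
  case (Cons v vs)
  let ?W = "Pair t -` W"
  have o: "open ?W" by (rule open_vimage[OF W]) (intro continuous_intros)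
  let ?G = "\<lambda>p. frechet_derivative F (at p) (0, v)"
  have eq: "frechet_derivative (\<lambda>y. F (t, y)) (at x) v = ?G (t, x)" if "x \<in> ?W" for x
  proof -
    have F': "(F has_derivative frechet_derivative F (at (t, x))) (at (t, x))"
      using Cons.prems that unfolding smooth_open_def
      by (metis frechet_derivative_works iter_deriv.simps(1) vimageE)
    have "(Pair t has_derivative (\<lambda>v. (0, v))) (at x)" by (auto intro!: derivative_eq_intros)
    from diff_chain_at[OF this F']
    have "((\<lambda>y. F (t, y)) has_derivative (\<lambda>v. frechet_derivative F (at (t, x)) (0, v))) (at x)"
      by (simp add: o_def)
    from frechet_derivative_at[OF this] show ?thesis by metis
  qed
  have "smooth_open W ?G"
    using Cons.prems unfolding smooth_open_def by (metis iter_deriv.simps(2))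
  from Cons.IH[OF this] have "iter_deriv vs (\<lambda>y. ?G (t, y)) y = iter_deriv (map (Pair 0) (v # vs)) F (t, y)"
    by simp
  moreover have "iter_deriv vs (\<lambda>x. frechet_derivative (\<lambda>y. F (t, y)) (at x) v) y
      = iter_deriv vs (\<lambda>y. ?G (t, y)) y"
    by (rule iter_deriv_cong_open[OF o]) (use p eq in auto)
  ultimately show ?case by simp
qed simp

lemma smooth_open_iter_deriv_continuous: "smooth_open W F \<Longrightarrow> continuous_on W (iter_deriv vs F)"
  unfolding smooth_open_def
  by (meson continuous_at_imp_continuous_on differentiable_imp_continuous_within)

text \<open>The parameter set need not be open: the local extensions that define smoothness agree with the
  family on whole slices, which are open in the second variable, and so have the same partial derivatives there.\<close>

lemma continuous_on_iter_deriv_family: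
  fixes f :: "'t::euclidean_space \<Rightarrow> 'e::euclidean_space \<Rightarrow> 'b::real_normed_vector"
  assumes f: "smooth_on S (\<lambda>(t, x). f t x)" and S: "openin (top_of_set (T \<times> X)) S" and X: "open X"
  shows "continuous_on S (\<lambda>(t, x). iter_deriv vs (f t) x)"
proof (rule continuous_on_eq_continuous_within[THEN iffD2], rule ballI)
  fix p assume p: "p \<in> S"
  then obtain W F where W: "open W" "p \<in> W" "smooth_open W F"
      "\<forall>q\<in>W \<inter> S. F q = (\<lambda>(t, x). f t x) q"
    using f unfolding smooth_on_iff by blast
  obtain N where N: "open N" "S = T \<times> X \<inter> N" using S by (auto simp: openin_open)
  let ?D = "\<lambda>(t, x). iter_deriv vs (f t) x"
  have eq: "iter_deriv (map (Pair 0) vs) F q = ?D q" if q: "q \<in> S \<inter> W" for q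
  proof -
    obtain t x where tx: "q = (t, x)" by (cases q)
    let ?N = "X \<inter> Pair t -` (N \<inter> W)"
    have "open (Pair t -` (N \<inter> W))"
      by (rule open_vimage) (use N(1) W(1) in \<open>auto intro!: continuous_intros\<close>)
    then have o: "open ?N" using X by blast
    have "iter_deriv vs (f t) x = iter_deriv vs (\<lambda>y. F (t, y)) x"
      by (rule iter_deriv_cong_open[OF o]) (use q N(2) W(4) tx in auto)
    also have "\<dots> = iter_deriv (map (Pair 0) vs) F (t, x)"
      using iter_deriv_slice[OF W(1,3)] q tx by auto
    finally show ?thesis using tx by simp
  qed
  have "continuous_on (S \<inter> W) ?D"
    using continuous_on_subset[OF smooth_open_iter_deriv_continuous[OF W(3)]]
    by (rule continuous_on_eq) (use eq in auto)
  then have "continuous (at p within S \<inter> W) ?D"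
    using p W(2) by (auto simp: continuous_on_eq_continuous_within)
  moreover have "at p within S \<inter> W = at p within S"
    by (rule at_within_nhd[OF W(2,1)]) auto
  ultimately show "continuous (at p within S) ?D" by simp
qed

text \<open>The tube lemma, in the form that projections along compact sets are closed.\<close>

lemma openin_all_compact:
  fixes T :: "'t::euclidean_space set" and X :: "'e::euclidean_space set"
  assumes S: "openin (top_of_set (T \<times> X)) S" and K: "compact K" "K \<subseteq> X"
  shows "openin (top_of_set T) {t \<in> T. \<forall>x\<in>K. (t, x) \<in> S}"
proof -
  obtain N where N: "open N" "S = T \<times> X \<inter> N" using S by (auto simp: openin_open)
  have "closedin (top_of_set (T \<times> K)) (T \<times> K \<inter> - N)"
    using N(1) by (auto simp: closedin_closed closed_Compl)
  then have "closedin (top_of_set T) (fst ` (T \<times> K \<inter> - N))"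
    by (rule Starlike.closed_map_fst[OF K(1)])
  then have "openin (top_of_set T) (T - fst ` (T \<times> K \<inter> - N))" by (metis openin_diff openin_subtopology_self)
  also have "T - fst ` (T \<times> K \<inter> - N) = {t \<in> T. \<forall>x\<in>K. (t, x) \<in> S}"
    using N(2) K(2) by force
  finally show ?thesis .
qed

text \<open>A smooth family of maps is continuous in the \<open>C\<^sup>\<infinity>\<close> topology: a subbasic neighbourhood imposes finitely
  many strict inequalities between continuous jets over a compact set, and by the tube lemma each
  of them is an open condition on the parameter.\<close>

theorem smooth_family_continuous_cinf:
  fixes M :: "('p, 'e::euclidean_space) smanifold" and T :: "'t::euclidean_space set"
  assumes f: "smooth_family M T f" and maps: "\<And>t. t \<in> T \<Longrightarrow> f t \<in> pts M \<rightarrow>\<^sub>E pts M"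
    and op: "\<And>U c. (U, c) \<in> atlas M \<Longrightarrow> open (c ` U)"
  shows "continuous_map (top_of_set T) (cinf_topology M) f"
proof -
  have fM: "f t \<in> smooth_maps M" if "t \<in> T" for t
    by (rule smooth_family_imp_smooth_maps[OF f that maps[OF that] op])
  have nbhd: "openin (top_of_set T) {t \<in> T. f t \<in> cinf_nbhd M g (U, c) (V, d) K r e}"
    if g: "g \<in> smooth_maps M" and U: "(U, c) \<in> atlas M" and V: "(V, d) \<in> atlas M"
      and K: "compact K" "K \<subseteq> c ` U" "g ` inv_into U c ` K \<subseteq> V"
    for g U c V d K r e
  proof -
    let ?X = "c ` U"
    let ?S = "{(t, x). t \<in> T \<and> x \<in> ?X \<and> f t (inv_into U c x) \<in> V}"
    let ?X' = "{x \<in> ?X. g (inv_into U c x) \<in> V}"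
    let ?f = "\<lambda>t x. d (f t (inv_into U c x))" and ?g = "\<lambda>x. d (g (inv_into U c x))"
    have S: "openin (top_of_set (T \<times> ?X)) ?S" "smooth_on ?S (\<lambda>(t, x). ?f t x)"
      using f U V unfolding smooth_family_def Let_def by fast+
    have g': "open ?X'" "smooth_on ?X' ?g"
      using g U V unfolding smooth_maps_def Let_def by fast+
    have X': "open ?X'" "smooth_open ?X' ?g"
      by (rule g'(1), rule smooth_on_open_iff[THEN iffD1, OF g'])
    \<comment> \<open>Only where \<open>g\<close> also lands in \<open>V\<close> do the two jets that are compared both vary continuously.\<close>
    define S' where "S' = ?S \<inter> UNIV \<times> ?X'"
    have S': "openin (top_of_set (T \<times> ?X)) S'"
      unfolding S'_def
      by (rule openin_Int_open[OF S(1) open_Times[OF open_UNIV X'(1)]])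
    define L where "L = {vs :: 'e list. set vs \<subseteq> Basis \<and> length vs \<le> r}"
    have L: "finite L" "L \<noteq> {}"
      unfolding L_def by (auto intro: finite_lists_length_le exI[of _ "[]"])
    let ?E = "\<lambda>vs (t, x). norm (iter_deriv vs (?f t) x - iter_deriv vs ?g x)"
    let ?O = "\<lambda>vs. S' \<inter> ?E vs -` {..<e}"
    have O: "openin (top_of_set (T \<times> ?X)) (?O vs)" for vs
    proof -
      have "continuous_on S' (\<lambda>(t, x). iter_deriv vs (?f t) x)"
        by (rule continuous_on_subset[OF continuous_on_iter_deriv_family[OF S(2,1) op[OF U]]])
          (simp add: S'_def)
      moreover have "continuous_on S' (\<lambda>p. iter_deriv vs ?g (snd p))"
        by (rule continuous_on_compose2[OF smooth_open_iter_deriv_continuous[OF X'(2)]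
              continuous_on_snd[OF continuous_on_id]]) (auto simp: S'_def)
      ultimately have "continuous_on S' (?E vs)"
        by (auto simp: case_prod_beta intro!: continuous_intros)
      then have "openin (top_of_set S') (?O vs)"
        by (rule continuous_openin_preimage_gen) simp
      then show ?thesis using S' by (rule openin_trans)
    qed
    have "{t \<in> T. f t \<in> cinf_nbhd M g (U, c) (V, d) K r e} =
        (\<Inter>vs\<in>L. {t \<in> T. \<forall>x\<in>K. (t, x) \<in> ?O vs})"
    proof -
      have KX: "x \<in> ?X'" if "x \<in> K" for x using K(2,3) that by auto
      show ?thesis
        using L(2) fM KX unfolding cinf_nbhd_def S'_def L_def by auto
    qed
    moreover have "openin (top_of_set T) (\<Inter>vs\<in>L. {t \<in> T. \<forall>x\<in>K. (t, x) \<in> ?O vs})"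
      using L by (intro openin_INT2 openin_all_compact[OF O K(1,2)])
    ultimately show ?thesis by simp
  qed
  show ?thesis
    unfolding cinf_topology_def
  proof (rule continuous_on_generated_topo)
    fix N assume "N \<in> insert (smooth_maps M)
         {cinf_nbhd M f (U, c) (V, d) K r e | f U c V d K r e.
            f \<in> smooth_maps M \<and> (U, c) \<in> atlas M \<and> (V, d) \<in> atlas M \<and>
            compact K \<and> K \<subseteq> c ` U \<and> f ` inv_into U c ` K \<subseteq> V \<and> 0 < e}"
    then show "openin (top_of_set T) (f -` N \<inter> topspace (top_of_set T))"
    proof (elim insertE CollectE exE conjE)
      assume "N = smooth_maps M"
      then have "f -` N \<inter> topspace (top_of_set T) = T" using fM by auto
      then show ?thesis by simp
    next
      fix g U c V d K r e
      assume N: "N = cinf_nbhd M g (U, c) (V, d) K r e"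
        and *: "g \<in> smooth_maps M" "(U, c) \<in> atlas M" "(V, d) \<in> atlas M" "compact K"
          "K \<subseteq> c ` U" "g ` inv_into U c ` K \<subseteq> V"
      have "f -` N \<inter> topspace (top_of_set T) = {t \<in> T. f t \<in> N}" by auto
      then show ?thesis using nbhd[OF *] unfolding N by simp
    qed
  qed (use fM in auto)
qed

section \<open>The torus action on the level set\<close>

text \<open>The weights of the two circle factors on the coordinates. They describe the torus action, its
  moment map (the quadratic functions whose level set is taken) and its infinitesimal action at once.\<close>

fun weight\<^sub>1 :: "'k \<Rightarrow> 'k + bool \<Rightarrow> int" where
  "weight\<^sub>1 l (Inl j) = (if j = l then 0 else 1)"
| "weight\<^sub>1 l (Inr t) = (if t then 0 else 1)"

fun weight\<^sub>2 :: "('k \<Rightarrow> int) \<Rightarrow> 'k \<Rightarrow> 'k + bool \<Rightarrow> int" where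
  "weight\<^sub>2 a l (Inl j) = (if j = l then 1 else - a j)"
| "weight\<^sub>2 a l (Inr t) = (if t then 1 else 0)"

definition torus_char :: "('k \<Rightarrow> int) \<Rightarrow> 'k \<Rightarrow> complex \<Rightarrow> complex \<Rightarrow> 'k + bool \<Rightarrow> complex" where
  "torus_char a l \<mu> \<epsilon> i = \<mu> powi weight\<^sub>1 l i * \<epsilon> powi weight\<^sub>2 a l i"

definition torus_act ::
  "('k::finite \<Rightarrow> int) \<Rightarrow> 'k \<Rightarrow> complex \<Rightarrow> complex \<Rightarrow> 'k ambient \<Rightarrow> 'k ambient" where
  "torus_act a l \<mu> \<epsilon> z = (\<chi> i. torus_char a l \<mu> \<epsilon> i * z $ i)"

lemma sum_ambient:
  fixes f :: "'k::finite + bool \<Rightarrow> 'b::comm_monoid_add"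
  shows "(\<Sum>i\<in>UNIV. f i) = (\<Sum>j\<in>UNIV. f (Inl j)) + (f (Inr False) + f (Inr True))"
  by (simp add: UNIV_Plus_UNIV[symmetric] sum.Plus UNIV_bool del: UNIV_Plus_UNIV)

lemma level_set_weights:
  "z \<in> level_set a l \<sigma> \<tau> \<longleftrightarrow>
     (\<Sum>i\<in>UNIV. of_int (weight\<^sub>1 l i) * (cmod (z $ i))\<^sup>2) = \<sigma> / pi \<and>
     (\<Sum>i\<in>UNIV. of_int (weight\<^sub>2 a l i) * (cmod (z $ i))\<^sup>2) = \<tau> / pi"
proof -
  have 1: "(\<Sum>i\<in>UNIV. of_int (weight\<^sub>1 l i) * (cmod (z $ i))\<^sup>2) =
      (\<Sum>j\<in>UNIV - {l}. (cmod (z $ Inl j))\<^sup>2) + (cmod (z $ Inr False))\<^sup>2"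
    by (simp add: sum_ambient sum.remove[of UNIV l])
  have 2: "(\<Sum>i\<in>UNIV. of_int (weight\<^sub>2 a l i) * (cmod (z $ i))\<^sup>2) =
      - (\<Sum>j\<in>UNIV - {l}. of_int (a j) * (cmod (z $ Inl j))\<^sup>2)
           + (cmod (z $ Inl l))\<^sup>2 + (cmod (z $ Inr True))\<^sup>2"
    by (simp add: sum_ambient sum.remove[of UNIV l] sum_negf)
  show ?thesis unfolding 1 2 level_set_def by simp
qed

lemma norm_torus_char: "\<mu> \<in> U1 \<Longrightarrow> \<epsilon> \<in> U1 \<Longrightarrow> cmod (torus_char a l \<mu> \<epsilon> i) = 1"
  by (simp add: torus_char_def norm_mult norm_power_int)

lemma orbit_rel_iff:
  "(z, w) \<in> orbit_rel a l \<sigma> \<tau> \<longleftrightarrow>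
     z \<in> level_set a l \<sigma> \<tau> \<and> (\<exists>\<epsilon>\<in>U1. \<exists>\<mu>\<in>U1. w = torus_act a l \<mu> \<epsilon> z)"
proof -
  have eq: "w = torus_act a l \<mu> \<epsilon> z \<longleftrightarrow>
      (\<forall>j. j \<noteq> l \<longrightarrow> w $ Inl j = \<mu> * \<epsilon> powi (- a j) * z $ Inl j) \<and>
           w $ Inl l = \<epsilon> * z $ Inl l \<and> w $ Inr True = \<epsilon> * z $ Inr True \<and>
           w $ Inr False = \<mu> * z $ Inr False" for \<mu> \<epsilon>
  proof -
    have "w = torus_act a l \<mu> \<epsilon> z \<longleftrightarrow>
        (\<forall>j. w $ Inl j = torus_char a l \<mu> \<epsilon> (Inl j) * z $ Inl j) \<and>
        (\<forall>t. w $ Inr t = torus_char a l \<mu> \<epsilon> (Inr t) * z $ Inr t)"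
      by (auto simp: vec_eq_iff torus_act_def split_sum_all)
    then show ?thesis
      by (auto simp: torus_char_def all_bool_eq)
  qed
  have "torus_act a l \<mu> \<epsilon> z \<in> level_set a l \<sigma> \<tau>"
    if "z \<in> level_set a l \<sigma> \<tau>" "\<mu> \<in> U1" "\<epsilon> \<in> U1" for \<mu> \<epsilon>
    using that by (simp add: level_set_weights torus_act_def norm_mult norm_torus_char)
  moreover have "(z, w) \<in> orbit_rel a l \<sigma> \<tau> \<longleftrightarrow> z \<in> level_set a l \<sigma> \<tau> \<and>
      w \<in> level_set a l \<sigma> \<tau> \<and> (\<exists>\<epsilon>\<in>U1. \<exists>\<mu>\<in>U1. w = torus_act a l \<mu> \<epsilon> z)"
    unfolding orbit_rel_def eq by simp
  ultimately show ?thesis by blast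
qed

lemma bounded_linear_vecI:
  fixes f :: "complex ^ 'i::finite \<Rightarrow> complex ^ 'j::finite"
  assumes "\<And>x y. f (x + y) = f x + f y" "\<And>r x. f (r *\<^sub>R x) = r *\<^sub>R f x"
  shows "bounded_linear f"
  using assms by (simp add: linear_iff flip: linear_conv_bounded_linear)

lemma bounded_linear_torus_act: "bounded_linear (torus_act a l \<mu> \<epsilon>)"
  by (rule bounded_linear_vecI) (auto simp: torus_act_def vec_eq_iff algebra_simps)

lemma omega_std_inner: "omega_std (\<chi> i. \<i> * of_real (c i) * z $ i) w = - (\<Sum>i\<in>UNIV. c i * (z $ i \<bullet> w $ i))"
  by (simp add: omega_std_def inner_complex_def algebra_simps flip: sum_negf)

lemma omega_std_antisym: "omega_std v w = - omega_std w v"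
  by (simp add: omega_std_def algebra_simps flip: sum_negf)

lemma omega_std_add_left: "omega_std (u + v) w = omega_std u w + omega_std v w"
  by (simp add: omega_std_def algebra_simps flip: sum.distrib)

lemma omega_std_torus_act:
  assumes "\<mu> \<in> U1" "\<epsilon> \<in> U1"
  shows "omega_std (torus_act a l \<mu> \<epsilon> v) (torus_act a l \<mu> \<epsilon> w) = omega_std v w"
proof -
  have key: "cnj (q * x) * (q * y) = cnj x * y" if "cmod q = 1" for q x y
  proof -
    have "cnj (q * x) * (q * y) = (q * cnj q) * (cnj x * y)" by (simp add: mult_ac)
    then show ?thesis using that by (simp flip: complex_norm_square)
  qed
  then show ?thesis
    by (simp only: omega_std_def torus_act_def vec_lambda_beta key[OF norm_torus_char[OF assms]])
qed

text \<open>Positivity of \<open>\<sigma>\<close>, \<open>\<tau>\<close> and \<open>\<tau> + a\<^sub>i \<sigma>\<close> makes the action free: a torus element is recovered from its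
  effect on a coordinate of weight \<open>(0, 1)\<close> and one of weight \<open>(1, _)\<close>, and at every point of the
  level set some coordinates of both kinds are nonzero.\<close>

lemma torus_free_coords:
  assumes "\<sigma> > 0" "\<tau> > 0" "\<And>i. i \<noteq> l \<Longrightarrow> \<tau> + of_int (a i) * \<sigma> > 0"
    and z: "z \<in> level_set a l \<sigma> \<tau>"
  obtains k m where "z $ k \<noteq> 0" "weight\<^sub>1 l k = 0" "weight\<^sub>2 a l k = 1"
    "z $ m \<noteq> 0" "weight\<^sub>1 l m = 1"
proof -
  let ?n = "\<lambda>i. (cmod (z $ i))\<^sup>2"
  have L: "(\<Sum>j\<in>UNIV - {l}. ?n (Inl j)) + ?n (Inr False) = \<sigma> / pi"
    "- (\<Sum>j\<in>UNIV - {l}. of_int (a j) * ?n (Inl j)) + ?n (Inl l) + ?n (Inr True) = \<tau> / pi"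
    using z by (auto simp: level_set_def)
  have m: "\<exists>m. z $ m \<noteq> 0 \<and> weight\<^sub>1 l m = 1"
  proof (rule ccontr)
    assume "\<not> ?thesis"
    then have *: "z $ m = 0" if "weight\<^sub>1 l m = 1" for m using that by blast
    have "?n (Inl j) = 0" if "j \<in> UNIV - {l}" for j using *[of "Inl j"] that by simp
    moreover have "?n (Inr False) = 0" using *[of "Inr False"] by simp
    ultimately show False using L(1) assms(1) by simp
  qed
  have k: "z $ Inl l \<noteq> 0 \<or> z $ Inr True \<noteq> 0"
  proof (rule ccontr)
    assume "\<not> ?thesis"
    then have "(\<Sum>j\<in>UNIV - {l}. of_int (a j) * ?n (Inl j)) = - \<tau> / pi" using L(2) by simp
    \<comment> \<open>The combination of the two level equations that eliminates their right-hand sides has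
      the positive coefficients \<open>\<tau> + a\<^sub>j \<sigma>\<close> and \<open>\<tau>\<close>.\<close>
    then have "\<sigma> * (\<Sum>j\<in>UNIV - {l}. of_int (a j) * ?n (Inl j)) +
        \<tau> * ((\<Sum>j\<in>UNIV - {l}. ?n (Inl j)) + ?n (Inr False)) = 0"
      unfolding L(1) by simp
    then have "(\<Sum>j\<in>UNIV - {l}. (\<tau> + of_int (a j) * \<sigma>) * ?n (Inl j)) + \<tau> * ?n (Inr False) = 0"
      by (simp add: sum_distrib_left sum.distrib algebra_simps)
    moreover have "(\<Sum>j\<in>UNIV - {l}. (\<tau> + of_int (a j) * \<sigma>) * ?n (Inl j)) \<ge> 0"
      using assms(3) by (intro sum_nonneg mult_nonneg_nonneg) (auto simp: less_imp_le)
    moreover have "\<tau> * ?n (Inr False) \<ge> 0" using assms(2) by simp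
    ultimately have "(\<Sum>j\<in>UNIV - {l}. (\<tau> + of_int (a j) * \<sigma>) * ?n (Inl j)) = 0"
      and F: "?n (Inr False) = 0" using assms(2) by (auto simp: add_nonneg_eq_0_iff)
    then have "\<forall>j\<in>UNIV - {l}. (\<tau> + of_int (a j) * \<sigma>) * ?n (Inl j) = 0"
      using assms(3) by (subst (asm) sum_nonneg_eq_0_iff) (auto simp: less_imp_le)
    then have "\<forall>j\<in>UNIV - {l}. ?n (Inl j) = 0" using assms(3) by force
    then show False using L(1) F assms(1) by simp
  qed
  obtain m where m: "z $ m \<noteq> 0" "weight\<^sub>1 l m = 1" using m by blast
  from k show ?thesis
  proof
    assume "z $ Inl l \<noteq> 0"
    with m show ?thesis by (intro that[of "Inl l" m]) auto
  next
    assume "z $ Inr True \<noteq> 0"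
    with m show ?thesis by (intro that[of "Inr True" m]) auto
  qed
qed

text \<open>The Lie algebra of the circle is the imaginary axis.\<close>

lemma unit_curve_derivative:
  fixes f :: "real \<Rightarrow> complex"
  assumes f: "(f has_vector_derivative d) (at 0)" "f 0 = 1" and u: "\<forall>\<^sub>F r in nhds 0. cmod (f r) = 1"
  shows "Re d = 0"
proof -
  have "((\<lambda>r. f r \<bullet> f r) has_derivative (\<lambda>h. f 0 \<bullet> (h *\<^sub>R d) + (h *\<^sub>R d) \<bullet> f 0)) (at 0)"
    using f(1) unfolding has_vector_derivative_def by (intro has_derivative_inner)
  moreover have "((\<lambda>r. f r \<bullet> f r) has_derivative (\<lambda>h. 0)) (at 0)"
  proof (rule has_derivative_transform_eventually[OF has_derivative_const[of 1]])
    show "\<forall>\<^sub>F r in at 0. 1 = f r \<bullet> f r"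
      using filter_leD[OF at_within_le_nhds u] by eventually_elim (simp add: norm_eq_1)
  qed (simp_all add: f(2))
  ultimately have "(\<lambda>h. f 0 \<bullet> (h *\<^sub>R d) + (h *\<^sub>R d) \<bullet> f 0) = (\<lambda>h. 0)"
    by (rule has_derivative_unique)
  from fun_cong[OF this, of 1] show ?thesis by (simp add: f(2) inner_complex_def)
qed

lemma has_vector_derivative_powi_unit:
  fixes f :: "real \<Rightarrow> complex"
  assumes "(f has_vector_derivative d) (at 0)" "f 0 = 1"
  shows "((\<lambda>r. f r powi n) has_vector_derivative of_int n * d) (at 0)"
proof -
  have "((\<lambda>x. x powi n) has_field_derivative of_int n * 1 powi (n - 1) * 1) (at (f 0))"
    using DERIV_power_int[OF DERIV_ident, of n "f 0" UNIV] by (simp add: assms(2))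
  from field_vector_diff_chain_at[OF assms(1) this] show ?thesis by (simp add: o_def mult.commute)
qed

lemma has_vector_derivative_nth:
  "(f has_vector_derivative d) F \<Longrightarrow> ((\<lambda>r. f r $ i) has_vector_derivative d $ i) F"
  by (rule bounded_linear.has_vector_derivative[OF bounded_linear_vec_nth])

text \<open>The two moment map components are constant along the curve, and these sums are half of their derivatives.\<close>

lemma level_set_tangent:
  fixes \<delta> :: "real \<Rightarrow> ('k::finite) ambient"
  assumes \<delta>: "smooth_curve_through (level_set a l \<sigma> \<tau>) z \<delta>" "(\<delta> has_vector_derivative w) (at 0)"
  shows "(\<Sum>i\<in>UNIV. of_int (weight\<^sub>1 l i) * (z $ i \<bullet> w $ i)) = 0"
    and "(\<Sum>i\<in>UNIV. of_int (weight\<^sub>2 a l i) * (z $ i \<bullet> w $ i)) = 0"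
proof -
  obtain e where e: "\<delta> 0 = z" "e > 0" "\<delta> ` {-e<..<e} \<subseteq> level_set a l \<sigma> \<tau>"
    using \<delta>(1) by (auto simp: smooth_curve_through_def)
  have key: "(\<Sum>i\<in>UNIV. wt i * (z $ i \<bullet> w $ i)) = 0"
    if wt: "\<And>y. y \<in> level_set a l \<sigma> \<tau> \<Longrightarrow> (\<Sum>i\<in>UNIV. wt i * (cmod (y $ i))\<^sup>2) = C" for wt C
  proof -
    let ?Q = "\<lambda>r. \<Sum>i\<in>UNIV. wt i * (\<delta> r $ i \<bullet> \<delta> r $ i)"
    have "(?Q has_derivative (\<lambda>h. \<Sum>i\<in>UNIV. wt i * (\<delta> 0 $ i \<bullet> (h *\<^sub>R w $ i) + (h *\<^sub>R w $ i) \<bullet> \<delta> 0 $ i))) (at 0)"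
      using has_vector_derivative_nth[OF \<delta>(2)] unfolding has_vector_derivative_def
      by (intro has_derivative_sum has_derivative_mult_right has_derivative_inner)
    moreover have "(?Q has_derivative (\<lambda>h. 0)) (at 0)"
    proof (rule has_derivative_transform_within_open[OF has_derivative_const[of C]])
      show "C = ?Q r" if "r \<in> {-e<..<e}" for r
      proof -
        have "\<delta> r \<in> level_set a l \<sigma> \<tau>" using e(3) that by blast
        from wt[OF this] show ?thesis by (simp add: power2_norm_eq_inner)
      qed
    qed (use e(2) in auto)
    ultimately have "(\<lambda>h. \<Sum>i\<in>UNIV. wt i * (\<delta> 0 $ i \<bullet> (h *\<^sub>R w $ i) + (h *\<^sub>R w $ i) \<bullet> \<delta> 0 $ i)) = (\<lambda>h. 0)"
      by (rule has_derivative_unique)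
    from fun_cong[OF this, of 1] have "(\<Sum>i\<in>UNIV. 2 * (wt i * (z $ i \<bullet> w $ i))) = 0"
      by (simp add: e(1) inner_commute algebra_simps)
    then show ?thesis by (simp flip: sum_distrib_left)
  qed
  show "(\<Sum>i\<in>UNIV. of_int (weight\<^sub>1 l i) * (z $ i \<bullet> w $ i)) = 0"
    by (rule key[of _ "\<sigma> / pi"]) (simp add: level_set_weights)
  show "(\<Sum>i\<in>UNIV. of_int (weight\<^sub>2 a l i) * (z $ i \<bullet> w $ i)) = 0"
    by (rule key[of _ "\<tau> / pi"]) (simp add: level_set_weights)
qed

text \<open>The torus elements that carry one curve to the other depend differentiably on time, because they
  are quotients of coordinates. So the velocities differ by an infinitesimal torus rotation of \<open>z\<close>, and
  pairing this with \<open>w\<close> gives the derivatives of the two defining equations along \<open>w\<close>, which vanish.\<close>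

lemma orbit_directions_null:
  fixes a :: "'k::finite \<Rightarrow> int"
  assumes pos: "\<sigma> > 0" "\<tau> > 0" "\<And>i. i \<noteq> l \<Longrightarrow> \<tau> + of_int (a i) * \<sigma> > 0"
    and 0: "\<gamma> 0 = z" "\<rho> 0 = z"
    and d: "(\<gamma> has_vector_derivative v) (at 0)" "(\<rho> has_vector_derivative v') (at 0)"
    and rel: "\<forall>\<^sub>F r in nhds 0. (\<gamma> r, \<rho> r) \<in> orbit_rel a l \<sigma> \<tau>"
    and \<delta>: "smooth_curve_through (level_set a l \<sigma> \<tau>) z \<delta>" "(\<delta> has_vector_derivative w) (at 0)"
  shows "omega_std v w = omega_std v' w"
proof -
  have z: "z \<in> level_set a l \<sigma> \<tau>"
    using eventually_nhds_x_imp_x[OF rel] 0 by (auto simp: orbit_rel_iff)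
  obtain k m where k: "z $ k \<noteq> 0" "weight\<^sub>1 l k = 0" "weight\<^sub>2 a l k = 1"
    and m: "z $ m \<noteq> 0" "weight\<^sub>1 l m = 1"
    by (rule torus_free_coords[OF pos z]) (assumption | rule that)+
  \<comment> \<open>The torus element \<open>(M r, E r)\<close> carrying \<open>\<gamma> r\<close> to \<open>\<rho> r\<close>, read off from the coordinates of
    weights \<open>(0, 1)\<close> and \<open>(1, _)\<close> that do not vanish at \<open>z\<close>.\<close>
  define E where "E r = \<rho> r $ k / \<gamma> r $ k" for r
  define M where "M r = \<rho> r $ m / \<gamma> r $ m * E r powi (- weight\<^sub>2 a l m)" for r
  have nz: "\<forall>\<^sub>F r in nhds 0. \<gamma> r $ i \<noteq> 0" if "z $ i \<noteq> 0" for i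
  proof -
    have "isCont (\<lambda>r. \<gamma> r $ i) 0"
      using has_vector_derivative_continuous[OF has_vector_derivative_nth[OF d(1)]] .
    then have "((\<lambda>r. \<gamma> r $ i) \<longlongrightarrow> z $ i) (nhds 0)"
      using 0 tendsto_at_iff_tendsto_nhds[of "\<lambda>r. \<gamma> r $ i" 0] by (simp add: isCont_def)
    then show ?thesis using tendsto_imp_eventually_ne that by blast
  qed
  have ev: "\<forall>\<^sub>F r in nhds 0. cmod (E r) = 1 \<and> cmod (M r) = 1 \<and>
      (\<forall>i. \<rho> r $ i = M r powi weight\<^sub>1 l i * E r powi weight\<^sub>2 a l i * \<gamma> r $ i)"
    using rel nz[OF k(1)] nz[OF m(1)]
  proof eventually_elim
    case (elim r)
    obtain \<epsilon> \<mu> where \<epsilon>: "\<epsilon> \<in> U1" "\<mu> \<in> U1" and \<rho>: "\<rho> r = torus_act a l \<mu> \<epsilon> (\<gamma> r)"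
      using elim(1) by (auto simp: orbit_rel_iff)
    have "\<epsilon> \<noteq> 0" using \<epsilon> by auto
    have "E r = \<epsilon>" using elim(2) k unfolding E_def \<rho> torus_act_def torus_char_def by simp
    moreover from this have "M r = \<mu>"
      using elim(3) m(2) \<open>\<epsilon> \<noteq> 0\<close> unfolding M_def \<rho> torus_act_def torus_char_def
      by (simp add: power_int_minus)
    ultimately show ?case using \<epsilon> by (simp add: \<rho> torus_act_def torus_char_def)
  qed
  have E0: "E 0 = 1" and M0: "M 0 = 1" using 0 k(1) m(1) by (simp_all add: E_def M_def)
  have quot: "(\<lambda>r. \<rho> r $ i / \<gamma> r $ i) differentiable (at 0)" if "z $ i \<noteq> 0" for i
    by (rule differentiable_divide)
      (use that 0 has_vector_derivative_nth[OF d(1), of i] has_vector_derivative_nth[OF d(2), of i] in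
        \<open>auto simp: has_vector_derivative_def intro: differentiableI\<close>)
  obtain E' where E': "(E has_vector_derivative E') (at 0)"
    using quot[OF k(1)] unfolding E_def[abs_def] vector_derivative_works by blast
  obtain M' where M': "(M has_vector_derivative M') (at 0)"
    using has_vector_derivative_mult[OF quot[OF m(1), unfolded vector_derivative_works]
        has_vector_derivative_powi_unit[OF E' E0]] unfolding M_def[abs_def] by blast
  have re: "Re E' = 0" "Re M' = 0"
    by (rule unit_curve_derivative[OF E' E0], use ev in \<open>auto elim: eventually_mono\<close>)
      (rule unit_curve_derivative[OF M' M0], use ev in \<open>auto elim: eventually_mono\<close>)
  let ?c = "\<lambda>i. of_int (weight\<^sub>1 l i) * Im M' + of_int (weight\<^sub>2 a l i) * Im E'"
  have v': "v' = v + (\<chi> i. \<i> * of_real (?c i) * z $ i)"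
  proof (rule vec_eq_iff[THEN iffD2], rule allI)
    fix i
    let ?f = "\<lambda>r. M r powi weight\<^sub>1 l i * E r powi weight\<^sub>2 a l i * \<gamma> r $ i"
    have f1: "(?f has_vector_derivative (1 * (of_int (weight\<^sub>2 a l i) * E') + of_int (weight\<^sub>1 l i) * M' * 1) * z $ i
          + 1 * v $ i) (at 0)"
      using has_vector_derivative_mult[OF has_vector_derivative_mult[OF
        has_vector_derivative_powi_unit[OF M' M0, of "weight\<^sub>1 l i"]
        has_vector_derivative_powi_unit[OF E' E0, of "weight\<^sub>2 a l i"]]
        has_vector_derivative_nth[OF d(1), of i]] by (simp add: M0 E0 0 algebra_simps)
    have f2: "(?f has_vector_derivative v' $ i) (at 0)"
    proof -
      have eq: "\<forall>\<^sub>F r in nhds 0. \<rho> r $ i = ?f r" using ev by eventually_elim auto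
      have "((\<lambda>r. \<rho> r $ i) has_derivative (\<lambda>h. h *\<^sub>R v' $ i)) (at 0)"
        using has_vector_derivative_nth[OF d(2), of i] by (simp add: has_vector_derivative_def)
      then have "(?f has_derivative (\<lambda>h. h *\<^sub>R v' $ i)) (at 0)"
        by (rule has_derivative_transform_eventually)
          (use eventually_nhds_x_imp_x[OF eq] filter_leD[OF at_within_le_nhds eq] in auto)
      then show ?thesis by (simp add: has_vector_derivative_def)
    qed
    have "v' $ i = (1 * (of_int (weight\<^sub>2 a l i) * E') + of_int (weight\<^sub>1 l i) * M' * 1) * z $ i
          + 1 * v $ i"
      by (rule vector_derivative_unique_at[OF f2 f1])
    also have "\<dots> = v $ i + (of_int (weight\<^sub>2 a l i) * E' + of_int (weight\<^sub>1 l i) * M') * z $ i"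
      by simp
    also have "of_int (weight\<^sub>2 a l i) * E' + of_int (weight\<^sub>1 l i) * M' = \<i> * of_real (?c i)"
      using re by (simp add: complex_eq_iff)
    finally show "v' $ i = (v + (\<chi> i. \<i> * of_real (?c i) * z $ i)) $ i"
      by simp
  qed
  have "(\<Sum>i\<in>UNIV. ?c i * (z $ i \<bullet> w $ i)) =
      Im M' * (\<Sum>i\<in>UNIV. of_int (weight\<^sub>1 l i) * (z $ i \<bullet> w $ i)) +
      Im E' * (\<Sum>i\<in>UNIV. of_int (weight\<^sub>2 a l i) * (z $ i \<bullet> w $ i))"
    by (simp add: sum_distrib_left sum.distrib algebra_simps)
  then have "(\<Sum>i\<in>UNIV. ?c i * (z $ i \<bullet> w $ i)) = 0"
    using level_set_tangent[OF \<delta>] by simp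
  then show ?thesis unfolding v' omega_std_add_left omega_std_inner by simp
qed

lemma symplectic_reduction_toric:
  fixes a :: "'k::finite \<Rightarrow> int"
  assumes pos: "\<sigma> > 0" "\<tau> > 0" "\<And>i. i \<noteq> l \<Longrightarrow> \<tau> + of_int (a i) * \<sigma> > 0"
  shows "symplectic_reduction (level_set a l \<sigma> \<tau>) (orbit_rel a l \<sigma> \<tau>) omega_std"
proof
  show "equiv (level_set a l \<sigma> \<tau>) (orbit_rel a l \<sigma> \<tau>)" by (rule equiv_orbit_rel)
  show "omega_std v w = - omega_std w v" for v w :: "'k ambient" by (rule omega_std_antisym)
  show "\<exists>g. bounded_linear g \<and> g z = z' \<and> (\<forall>y\<in>level_set a l \<sigma> \<tau>. (y, g y) \<in> orbit_rel a l \<sigma> \<tau>) \<and>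
        (\<forall>v w. omega_std (g v) (g w) = omega_std v w)" if "(z, z') \<in> orbit_rel a l \<sigma> \<tau>" for z z'
  proof -
    obtain \<epsilon> \<mu> where \<epsilon>: "\<epsilon> \<in> U1" "\<mu> \<in> U1" "z' = torus_act a l \<mu> \<epsilon> z"
      using \<open>(z, z') \<in> _\<close> by (auto simp: orbit_rel_iff)
    have "(y, torus_act a l \<mu> \<epsilon> y) \<in> orbit_rel a l \<sigma> \<tau>" if "y \<in> level_set a l \<sigma> \<tau>" for y
      unfolding orbit_rel_iff using that \<epsilon>(1,2) by blast
    with \<epsilon> show ?thesis
      using bounded_linear_torus_act[of a l \<mu> \<epsilon>] omega_std_torus_act[of \<mu> \<epsilon> a l]
      by (intro exI[of _ "torus_act a l \<mu> \<epsilon>"]) auto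
  qed
qed (rule orbit_directions_null[OF pos])

section \<open>Rotations of the ambient space\<close>

text \<open>The real rotation by the angle \<open>\<theta>\<close> of the plane spanned by the coordinates of index \<open>n\<close> and \<open>n + 2\<close>. Both
  have the same torus weights, so it commutes with the torus action.\<close>

definition rotate_plane :: "'k::finite \<Rightarrow> real \<Rightarrow> 'k ambient \<Rightarrow> 'k ambient" where
  "rotate_plane l \<theta> z = (\<chi> i.
     if i = Inl l then cos \<theta> *\<^sub>R z $ Inl l - sin \<theta> *\<^sub>R z $ Inr True
     else if i = Inr True then sin \<theta> *\<^sub>R z $ Inl l + cos \<theta> *\<^sub>R z $ Inr True
     else z $ i)"

lemma rotate_plane_add: "rotate_plane l \<theta> (rotate_plane l \<phi> z) = rotate_plane l (\<theta> + \<phi>) z"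
  by (simp add: rotate_plane_def vec_eq_iff cos_add sin_add algebra_simps)

lemma rotate_plane_0: "rotate_plane l 0 z = z"
  by (simp add: rotate_plane_def vec_eq_iff)

lemma bounded_linear_rotate_plane: "bounded_linear (rotate_plane l \<theta>)"
  by (rule bounded_linear_vecI) (auto simp: rotate_plane_def vec_eq_iff algebra_simps)

lemma rotate_plane_torus_act: "rotate_plane l \<theta> (torus_act a l \<mu> \<epsilon> z) = torus_act a l \<mu> \<epsilon> (rotate_plane l \<theta> z)"
  by (simp add: rotate_plane_def torus_act_def torus_char_def vec_eq_iff algebra_simps)

lemma rotation_inner:
  fixes x y x' y' :: "'a::real_inner"
  shows "(cos \<theta> *\<^sub>R x - sin \<theta> *\<^sub>R y) \<bullet> (cos \<theta> *\<^sub>R x' - sin \<theta> *\<^sub>R y') +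
    (sin \<theta> *\<^sub>R x + cos \<theta> *\<^sub>R y) \<bullet> (sin \<theta> *\<^sub>R x' + cos \<theta> *\<^sub>R y') = x \<bullet> x' + y \<bullet> y'"
proof -
  have "(c *\<^sub>R x - s *\<^sub>R y) \<bullet> (c *\<^sub>R x' - s *\<^sub>R y') + (s *\<^sub>R x + c *\<^sub>R y) \<bullet> (s *\<^sub>R x' + c *\<^sub>R y') =
      (c\<^sup>2 + s\<^sup>2) * (x \<bullet> x' + y \<bullet> y')" for c s
    by (simp add: inner_diff_left inner_diff_right inner_add_left inner_add_right power2_eq_square
        algebra_simps)
  then show ?thesis by simp
qed

lemma rotate_plane_level_set:
  assumes "z \<in> level_set a l \<sigma> \<tau>"
  shows "rotate_plane l \<theta> z \<in> level_set a l \<sigma> \<tau>"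
proof -
  have "(cmod (rotate_plane l \<theta> z $ Inl l))\<^sup>2 + (cmod (rotate_plane l \<theta> z $ Inr True))\<^sup>2 =
      (cmod (z $ Inl l))\<^sup>2 + (cmod (z $ Inr True))\<^sup>2"
    using rotation_inner[of \<theta> "z $ Inl l" "z $ Inr True" "z $ Inl l" "z $ Inr True"]
    by (simp add: rotate_plane_def power2_norm_eq_inner)
  moreover have "rotate_plane l \<theta> z $ Inl j = z $ Inl j" if "j \<in> UNIV - {l}" for j
    using that by (simp add: rotate_plane_def)
  moreover have "rotate_plane l \<theta> z $ Inr False = z $ Inr False" by (simp add: rotate_plane_def)
  ultimately show ?thesis using assms by (simp add: level_set_def)
qed

lemma rotate_plane_orbit_rel:
  "(z, w) \<in> orbit_rel a l \<sigma> \<tau> \<Longrightarrow> (rotate_plane l \<theta> z, rotate_plane l \<theta> w) \<in> orbit_rel a l \<sigma> \<tau>"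
  unfolding orbit_rel_iff using rotate_plane_level_set rotate_plane_torus_act by blast

lemma omega_std_rotate_plane: "omega_std (rotate_plane l \<theta> v) (rotate_plane l \<theta> w) = omega_std v w"
proof -
  \<comment> \<open>The standard form is the inner product with one argument rotated by the complex structure,
    so that the invariance of inner products under rotations applies.\<close>
  have o: "Im (cnj x * y) = x \<bullet> (- \<i> * y)" for x y
    by (simp add: inner_complex_def)
  have split: "(\<Sum>i\<in>UNIV. f i) = (f (Inl l) + f (Inr True)) + (\<Sum>i\<in>UNIV - {Inl l, Inr True}. f i)"
    for f :: "'a + bool \<Rightarrow> real"
    by (simp add: sum.subset_diff[of "{Inl l, Inr True}" UNIV])
  have "(\<Sum>i\<in>UNIV - {Inl l, Inr True}. Im (cnj (rotate_plane l \<theta> v $ i) * rotate_plane l \<theta> w $ i)) =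
      (\<Sum>i\<in>UNIV - {Inl l, Inr True}. Im (cnj (v $ i) * w $ i))"
    by (intro sum.cong) (auto simp: rotate_plane_def)
  moreover have "Im (cnj (rotate_plane l \<theta> v $ Inl l) * rotate_plane l \<theta> w $ Inl l) +
      Im (cnj (rotate_plane l \<theta> v $ Inr True) * rotate_plane l \<theta> w $ Inr True) =
      Im (cnj (v $ Inl l) * w $ Inl l) + Im (cnj (v $ Inr True) * w $ Inr True)"
    using rotation_inner[of \<theta> "v $ Inl l" "v $ Inr True" "- \<i> * w $ Inl l" "- \<i> * w $ Inr True"]
    unfolding o by (simp add: rotate_plane_def algebra_simps)
  ultimately show ?thesis unfolding omega_std_def split by simp
qed

lemma descends_bij:
  assumes "equiv Z R" "\<And>z w. (z, w) \<in> R \<Longrightarrow> (f z, f w) \<in> R" "\<And>z w. (z, w) \<in> R \<Longrightarrow> (g z, g w) \<in> R"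
    and "\<And>z. f (g z) = z" "\<And>z. g (f z) = z"
  shows "descends Z R f"
  unfolding descends_def
proof (intro ballI conjI)
  fix z assume "z \<in> Z"
  then have "(z, z) \<in> R" using assms(1) by (auto simp: equiv_def refl_on_def)
  then show "f z \<in> Z" using assms(1,2) by (auto simp: equiv_def)
  show "f ` (R `` {z}) = R `` {f z}"
  proof
    show "f ` (R `` {z}) \<subseteq> R `` {f z}" using assms(2) by auto
    show "R `` {f z} \<subseteq> f ` (R `` {z})"
    proof
      fix w assume "w \<in> R `` {f z}"
      then have "(z, g w) \<in> R" using assms(3)[of "f z" w] assms(5) by simp
      then show "w \<in> f ` (R `` {z})" using assms(4)[of w] by (metis Image_singleton_iff image_eqI)
    qed
  qed
qed

lemma rotate_coords_mult: "rotate_coords b u (rotate_coords b v z) = rotate_coords b (u * v) z"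
  by (simp add: rotate_coords_def vec_eq_iff power_int_mult_distrib split: sum.split)

lemma rotate_coords_1: "rotate_coords b 1 z = z"
  by (simp add: rotate_coords_def vec_eq_iff split: sum.split)

text \<open>The circle action \<open>rotate_coords b\<close> conjugated by the plane rotation. As \<open>\<theta>\<close> runs from \<open>0\<close> to \<open>\<pi> / 2\<close>
  the factor \<open>u powi b\<^sub>l\<close> moves from coordinate \<open>n\<close> to coordinate \<open>n + 2\<close>.\<close>

definition tilted_rotation :: "'k::finite \<Rightarrow> int ^ 'k \<Rightarrow> real \<Rightarrow> complex \<Rightarrow> 'k ambient \<Rightarrow> 'k ambient" where
  "tilted_rotation l b \<theta> u z = rotate_plane l \<theta> (rotate_coords b u (rotate_plane l (- \<theta>) z))"

lemma tilted_rotation_mult: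
  "tilted_rotation l b \<theta> u (tilted_rotation l b \<theta> v z) = tilted_rotation l b \<theta> (u * v) z"
  by (simp add: tilted_rotation_def rotate_plane_add rotate_plane_0 rotate_coords_mult)

lemma tilted_rotation_1: "tilted_rotation l b \<theta> 1 z = z"
  by (simp add: tilted_rotation_def rotate_plane_add rotate_plane_0 rotate_coords_1)

lemma descends_tilted_rotation:
  assumes "u \<in> U1"
  shows "descends (level_set a l \<sigma> \<tau>) (orbit_rel a l \<sigma> \<tau>) (tilted_rotation l b \<theta> u)"
proof (rule descends_bij[OF equiv_orbit_rel, where g = "tilted_rotation l b \<theta> (inverse u)"])
  have "u \<noteq> 0" "inverse u \<in> U1" using assms by (auto simp: norm_inverse)
  then show "tilted_rotation l b \<theta> u (tilted_rotation l b \<theta> (inverse u) z) = z"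
    "tilted_rotation l b \<theta> (inverse u) (tilted_rotation l b \<theta> u z) = z" for z
    by (simp_all add: tilted_rotation_mult tilted_rotation_1)
  show "(tilted_rotation l b \<theta> u z, tilted_rotation l b \<theta> u w) \<in> orbit_rel a l \<sigma> \<tau>"
    "(tilted_rotation l b \<theta> (inverse u) z, tilted_rotation l b \<theta> (inverse u) w) \<in> orbit_rel a l \<sigma> \<tau>"
    if "(z, w) \<in> orbit_rel a l \<sigma> \<tau>" for z w
    using that assms \<open>inverse u \<in> U1\<close> unfolding tilted_rotation_def
    by (intro rotate_plane_orbit_rel rotate_coords_orbit_rel; simp)+
qed

lemma smooth_on_rotate_plane:
  assumes "smooth_on S \<theta>" "smooth_on S f"
  shows "smooth_on S (\<lambda>p. rotate_plane l (\<theta> p) (f p))"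
  unfolding rotate_plane_def
proof (rule smooth_on_vec)
  fix i
  have c: "smooth_on S (\<lambda>p. cos (\<theta> p))" "smooth_on S (\<lambda>p. sin (\<theta> p))"
    by (rule smooth_on_compose[OF assms(1) smooth_on_cos[of UNIV]], simp)
      (rule smooth_on_compose[OF assms(1) smooth_on_sin[of UNIV]], simp)
  note n = smooth_on_nth[OF assms(2)]
  show "smooth_on S (\<lambda>p. if i = Inl l then cos (\<theta> p) *\<^sub>R f p $ Inl l - sin (\<theta> p) *\<^sub>R f p $ Inr True
     else if i = Inr True then sin (\<theta> p) *\<^sub>R f p $ Inl l + cos (\<theta> p) *\<^sub>R f p $ Inr True
     else f p $ i)"
    using smooth_on_diff[OF smooth_on_scaleR[OF c(1) n] smooth_on_scaleR[OF c(2) n]]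
      smooth_on_add[OF smooth_on_scaleR[OF c(2) n] smooth_on_scaleR[OF c(1) n]] n
    by (cases "i = Inl l"; cases "i = Inr True") simp_all
qed

lemma smooth_on_powi_U1:
  assumes "smooth_on S u" "\<And>p. p \<in> S \<Longrightarrow> u p \<in> U1"
  shows "smooth_on S (\<lambda>p. u p powi k)"
proof (cases "k \<ge> 0")
  case True
  then show ?thesis using smooth_on_power[OF assms(1), of "nat k"] by (simp add: power_int_def)
next
  case False
  \<comment> \<open>On the unit circle inversion is conjugation, which is smooth on the whole plane.\<close>
  have "smooth_on S (\<lambda>p. cnj (u p) ^ nat (- k))"
    by (rule smooth_on_power[OF smooth_on_bounded_linear[OF bounded_linear_cnj assms(1)]])
  then show ?thesis
  proof (rule smooth_on_cong)
    fix p assume "p \<in> S"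
    then have "cnj (u p) = inverse (u p)" using assms(2)[of p] by (simp add: inverse_complex_def complex_eq_iff complex_norm cmod_def)
    then show "cnj (u p) ^ nat (- k) = u p powi k" using False by (simp add: power_int_def)
  qed
qed

lemma smooth_on_tilted_rotation:
  fixes \<theta> :: "'t::euclidean_space \<Rightarrow> real"
  assumes "smooth_on S \<theta>" "smooth_on S u" "smooth_on S f" "\<And>p. p \<in> S \<Longrightarrow> u p \<in> U1"
  shows "smooth_on S (\<lambda>p. tilted_rotation l b (\<theta> p) (u p) (f p))"
  unfolding tilted_rotation_def
proof (rule smooth_on_rotate_plane[OF assms(1)])
  note m = smooth_on_rotate_plane[OF smooth_on_minus[OF assms(1)] assms(3), of l]
  show "smooth_on S (\<lambda>p. rotate_coords b (u p) (rotate_plane l (- \<theta> p) (f p)))"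
    unfolding rotate_coords_def
  proof (rule smooth_on_vec)
    fix i
    show "smooth_on S (\<lambda>p. case i of Inl j \<Rightarrow> u p powi (b $ j) * rotate_plane l (- \<theta> p) (f p) $ Inl j
      | Inr _ \<Rightarrow> rotate_plane l (- \<theta> p) (f p) $ i)"
      using smooth_on_mult[OF smooth_on_powi_U1[OF assms(2,4)] smooth_on_nth[OF m]] smooth_on_nth[OF m]
      by (cases i) simp_all
  qed
qed

lemma tilted_rotation_U1_smooth:
  fixes T :: "(real \<times> complex) set"
  assumes "snd ` T \<subseteq> U1"
  shows "smooth_on (T \<times> Z) (\<lambda>(p, z). tilted_rotation l b (\<kappa> * fst p) (snd p) z)"
proof -
  have "smooth_on (T \<times> Z) (\<lambda>q. \<kappa> * fst (fst q))" "smooth_on (T \<times> Z) (\<lambda>q. snd (fst q))"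
    "smooth_on (T \<times> Z) snd"
    by (intro smooth_on_linear bounded_linear_intros)+
  from smooth_on_tilted_rotation[OF this, of l b] assms show ?thesis
    by (force simp: case_prod_beta')
qed

section \<open>Circle actions on the toric manifold and their homotopy\<close>

text \<open>The Hamiltonian of the flow \<open>t \<mapsto> tilted_rotation l b \<theta> (cis (c * t))\<close>: the moment map of the
  diagonal rotation, evaluated in the rotated coordinates.\<close>

definition tilted_ham :: "'k::finite \<Rightarrow> int ^ 'k \<Rightarrow> real \<Rightarrow> real \<Rightarrow> 'k ambient \<Rightarrow> real" where
  "tilted_ham l b \<theta> c z = c / 2 * (\<Sum>j\<in>UNIV. of_int (b $ j) * (cmod (rotate_plane l (- \<theta>) z $ Inl j))\<^sup>2)"

text \<open>The velocity field of the same flow.\<close>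

definition tilted_gen :: "'k::finite \<Rightarrow> int ^ 'k \<Rightarrow> real \<Rightarrow> real \<Rightarrow> 'k ambient \<Rightarrow> 'k ambient" where
  "tilted_gen l b \<theta> c z = rotate_plane l \<theta>
     (\<chi> i. \<i> * of_real (case i of Inl j \<Rightarrow> c * of_int (b $ j) | Inr _ \<Rightarrow> 0) * rotate_plane l (- \<theta>) z $ i)"

lemma tilted_rotation_generator:
  "((\<lambda>r. tilted_rotation l b \<theta> (cis (c * r)) z) has_vector_derivative tilted_gen l b \<theta> c z) (at 0)"
  unfolding tilted_rotation_def tilted_gen_def rotate_coords_def
proof (intro bounded_linear.has_vector_derivative[OF bounded_linear_rotate_plane] has_vector_derivative_vec)
  fix i
  let ?y = "rotate_plane l (- \<theta>) z"
  show "((\<lambda>r. case i of Inl j \<Rightarrow> cis (c * r) powi (b $ j) * ?y $ Inl j | Inr _ \<Rightarrow> ?y $ i)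
      has_vector_derivative \<i> * of_real (case i of Inl j \<Rightarrow> c * of_int (b $ j) | Inr _ \<Rightarrow> 0) * ?y $ i) (at 0)"
  proof (cases i)
    case (Inl j)
    have "((\<lambda>r. cis (of_int (b $ j) * (c * r)) * ?y $ Inl j) has_derivative
        (\<lambda>h. h *\<^sub>R (\<i> * of_real (c * of_int (b $ j)) * ?y $ Inl j))) (at 0)"
      by (rule derivative_eq_intros refl)+ (simp add: fun_eq_iff scaleR_conv_of_real algebra_simps)
    then show ?thesis by (simp add: Inl has_vector_derivative_def cis_power_int)
  qed simp
qed

lemma tilted_ham_invariant:
  assumes "(z, w) \<in> orbit_rel a l \<sigma> \<tau>"
  shows "tilted_ham l b \<theta> c z = tilted_ham l b \<theta> c w"
proof -
  obtain \<epsilon> \<mu> where "\<epsilon> \<in> U1" "\<mu> \<in> U1" and w: "w = torus_act a l \<mu> \<epsilon> z"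
    using assms unfolding orbit_rel_iff by blast
  then have "cmod (rotate_plane l (- \<theta>) w $ i) = cmod (rotate_plane l (- \<theta>) z $ i)" for i
    unfolding w rotate_plane_torus_act by (simp add: torus_act_def norm_mult norm_torus_char)
  then show ?thesis by (simp add: tilted_ham_def)
qed

lemma smooth_on_tilted_ham: "smooth_on S (tilted_ham l b \<theta> c)"
proof -
  have n: "smooth_on S (\<lambda>z. rotate_plane l (- \<theta>) z $ i)" for i
    by (rule smooth_on_nth[OF smooth_on_linear[OF bounded_linear_rotate_plane]])
  have "smooth_on S (\<lambda>z. \<Sum>j\<in>UNIV. of_int (b $ j) *\<^sub>R (rotate_plane l (- \<theta>) z $ Inl j \<bullet> rotate_plane l (- \<theta>) z $ Inl j))"
    by (rule smooth_on_sum) (rule smooth_on_scaleR[OF smooth_on_const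
        smooth_on_bilinear[OF bounded_bilinear_inner n n]])
  from smooth_on_scaleR[OF smooth_on_const[of _ "c / 2"] this] show ?thesis
    by (simp add: tilted_ham_def[abs_def] power2_norm_eq_inner)
qed

lemma tilted_ham_has_derivative:
  "(tilted_ham l b \<theta> c has_derivative (\<lambda>w. - omega_std (tilted_gen l b \<theta> c z) w)) (at z)"
proof -
  let ?f = "\<lambda>z j. rotate_plane l (- \<theta>) z $ Inl j"
  have f: "((\<lambda>z. ?f z j) has_derivative (\<lambda>w. ?f w j)) (at z)" for j
    by (intro bounded_linear_imp_has_derivative
        bounded_linear_compose[OF bounded_linear_vec_nth bounded_linear_rotate_plane])
  have "((\<lambda>z. c / 2 * (\<Sum>j\<in>UNIV. of_int (b $ j) * (?f z j \<bullet> ?f z j))) has_derivative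
      (\<lambda>w. c / 2 * (\<Sum>j\<in>UNIV. of_int (b $ j) * (?f z j \<bullet> ?f w j + ?f w j \<bullet> ?f z j)))) (at z)"
    by (intro has_derivative_mult_right has_derivative_sum has_derivative_inner f)
  moreover have "c / 2 * (\<Sum>j\<in>UNIV. of_int (b $ j) * (?f z j \<bullet> ?f w j + ?f w j \<bullet> ?f z j)) =
      - omega_std (tilted_gen l b \<theta> c z) w" for w
  proof -
    have "omega_std (tilted_gen l b \<theta> c z) w =
        omega_std (tilted_gen l b \<theta> c z) (rotate_plane l \<theta> (rotate_plane l (- \<theta>) w))"
      by (simp add: rotate_plane_add rotate_plane_0)
    also have "\<dots> = - (\<Sum>j\<in>UNIV. c * of_int (b $ j) * (?f z j \<bullet> ?f w j))"
      unfolding tilted_gen_def omega_std_rotate_plane omega_std_inner by (simp add: sum_ambient)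
    finally show ?thesis
      by (simp add: sum_distrib_left inner_commute algebra_simps)
  qed
  ultimately show ?thesis
    by (simp add: tilted_ham_def[abs_def] power2_norm_eq_inner)
qed

lemma toric_manifold_eq:
  "toric_manifold a l \<sigma> \<tau> = reduced_manifold (level_set a l \<sigma> \<tau>) (orbit_rel a l \<sigma> \<tau>) omega_std"
  by (simp add: toric_manifold_def reduced_manifold_def)

definition tilted_action ::
  "('k::finite \<Rightarrow> int) \<Rightarrow> 'k \<Rightarrow> real \<Rightarrow> real \<Rightarrow> int ^ 'k \<Rightarrow> real \<Rightarrow> complex \<Rightarrow> 'k ambient set \<Rightarrow> 'k ambient set"
  where
  "tilted_action a l \<sigma> \<tau> b \<theta> u =
     induced_map (level_set a l \<sigma> \<tau>) (orbit_rel a l \<sigma> \<tau>) (tilted_rotation l b \<theta> u)"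

text \<open>A single element \<open>u = cis c\<close> is the time-one map of the flow with speed \<open>c\<close>.\<close>

lemma tilted_action_Ham:
  fixes a :: "'k::finite \<Rightarrow> int"
  assumes pos: "\<sigma> > 0" "\<tau> > 0" "\<And>i. i \<noteq> l \<Longrightarrow> \<tau> + of_int (a i) * \<sigma> > 0" and u: "u \<in> U1"
  shows "tilted_action a l \<sigma> \<tau> b \<theta> u \<in> Ham (toric_manifold a l \<sigma> \<tau>)"
proof -
  interpret symplectic_reduction "level_set a l \<sigma> \<tau>" "orbit_rel a l \<sigma> \<tau>" omega_std
    by (rule symplectic_reduction_toric[OF pos])
  define c where "c = Arg u"
  have "u \<noteq> 0" "sgn u = u" using u by (auto simp: sgn_div_norm)
  then have c: "cis (c * 1) = u" using cis_Arg[of u] by (simp add: c_def)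
  have "ham_isotopy (toric_manifold a l \<sigma> \<tau>) (\<lambda>_. descended_fun (tilted_ham l b \<theta> c))
      (\<lambda>t. tilted_action a l \<sigma> \<tau> b \<theta> (cis (c * t)))"
    unfolding toric_manifold_eq tilted_action_def
  proof (rule ham_isotopy_induced)
    have s: "smooth_on (UNIV :: (real \<times> 'k ambient) set) (\<lambda>q. cis (c * fst q))"
      by (rule smooth_on_compose[OF smooth_on_linear smooth_on_cis[of UNIV]])
        (auto intro!: bounded_linear_intros)
    have "smooth_on (UNIV :: (real \<times> 'k ambient) set) snd"
      by (rule smooth_on_linear[OF bounded_linear_snd])
    from smooth_on_tilted_rotation[OF smooth_on_const s this]
    show "smooth_on UNIV (\<lambda>(t, z). tilted_rotation l b \<theta> (cis (c * t)) z)"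
      by (simp add: case_prod_beta')
    show "descends (level_set a l \<sigma> \<tau>) (orbit_rel a l \<sigma> \<tau>) (tilted_rotation l b \<theta> (cis (c * t)))" for t
      by (rule descends_tilted_rotation) simp
    show "tilted_rotation l b \<theta> (cis (c * (s + t))) z =
        tilted_rotation l b \<theta> (cis (c * s)) (tilted_rotation l b \<theta> (cis (c * t)) z)" for s t z
      by (simp add: tilted_rotation_mult cis_mult distrib_left)
  qed (auto simp: tilted_rotation_1 intro: tilted_rotation_generator smooth_on_tilted_ham
      tilted_ham_invariant tilted_ham_has_derivative)
  then show ?thesis using c unfolding Ham_def by force
qed

lemma circle_hom_tilted_action:
  fixes a :: "'k::finite \<Rightarrow> int"
  assumes pos: "\<sigma> > 0" "\<tau> > 0" "\<And>i. i \<noteq> l \<Longrightarrow> \<tau> + of_int (a i) * \<sigma> > 0"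
  shows "circle_hom (toric_manifold a l \<sigma> \<tau>) (tilted_action a l \<sigma> \<tau> b \<theta>)"
  unfolding circle_hom_def
proof (intro conjI ballI)
  show "tilted_action a l \<sigma> \<tau> b \<theta> ` U1 \<subseteq> Ham (toric_manifold a l \<sigma> \<tau>)"
    by (rule image_subsetI) (rule tilted_action_Ham[OF pos])
  show "tilted_action a l \<sigma> \<tau> b \<theta> (u * v) =
      compose (pts (toric_manifold a l \<sigma> \<tau>)) (tilted_action a l \<sigma> \<tau> b \<theta> u) (tilted_action a l \<sigma> \<tau> b \<theta> v)"
    if "u \<in> U1" "v \<in> U1" for u v
  proof -
    have "tilted_rotation l b \<theta> (u * v) = (\<lambda>z. tilted_rotation l b \<theta> u (tilted_rotation l b \<theta> v z))"
      by (simp add: tilted_rotation_mult)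
    then show ?thesis
      by (simp add: tilted_action_def toric_manifold_def
          induced_map_compose descends_tilted_rotation[OF that(1)] descends_tilted_rotation[OF that(2)])
  qed
  have "smooth_on (U1 \<times> level_set a l \<sigma> \<tau>) (\<lambda>(u, z). tilted_rotation l b \<theta> u z)"
    unfolding case_prod_beta'
    by (rule smooth_on_tilted_rotation[OF smooth_on_const smooth_on_linear[OF bounded_linear_fst]
          smooth_on_linear[OF bounded_linear_snd]]) auto
  then show "smooth_family (toric_manifold a l \<sigma> \<tau>) U1 (tilted_action a l \<sigma> \<tau> b \<theta>)"
    unfolding toric_manifold_eq tilted_action_def[abs_def]
    by (rule smooth_family_induced) (rule descends_tilted_rotation)
qed

lemma psi_eq: "psi a l \<sigma> \<tau> b = tilted_action a l \<sigma> \<tau> b 0"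
  by (simp add: fun_eq_iff psi_def tilted_action_def tilted_rotation_def induced_map_def rotate_plane_0
      toric_manifold_def cong: restrict_cong image_cong)

text \<open>The angle is the homotopy parameter. Joint smoothness in angle and circle element gives the
  continuity of the homotopy.\<close>

lemma hom_homotopic_tilt:
  fixes a :: "'k::finite \<Rightarrow> int"
  assumes pos: "\<sigma> > 0" "\<tau> > 0" "\<And>i. i \<noteq> l \<Longrightarrow> \<tau> + of_int (a i) * \<sigma> > 0"
    and \<phi>: "circle_hom (toric_manifold a l \<sigma> \<tau>) \<phi>" "\<And>u. u \<in> U1 \<Longrightarrow> \<phi> u = tilted_action a l \<sigma> \<tau> b \<kappa> u"
  shows "hom_homotopic (toric_manifold a l \<sigma> \<tau>) (psi a l \<sigma> \<tau> b) \<phi>"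
proof -
  let ?M = "toric_manifold a l \<sigma> \<tau>"
  let ?\<Phi> = "\<lambda>s. tilted_action a l \<sigma> \<tau> b (\<kappa> * s)"
  let ?T = "{0..1} \<times> U1 :: (real \<times> complex) set"
  have hom: "circle_hom ?M (tilted_action a l \<sigma> \<tau> b \<theta>)" for \<theta>
    by (rule circle_hom_tilted_action[OF pos])
  have fam: "smooth_family ?M ?T (\<lambda>p. ?\<Phi> (fst p) (snd p))"
    unfolding toric_manifold_eq tilted_action_def
    by (rule smooth_family_induced)
      (auto intro!: tilted_rotation_U1_smooth descends_tilted_rotation)
  have "continuous_map (top_of_set ?T) (cinf_topology ?M) (\<lambda>p. ?\<Phi> (fst p) (snd p))"
  proof (rule smooth_family_continuous_cinf[OF fam])
    show "?\<Phi> (fst p) (snd p) \<in> pts ?M \<rightarrow>\<^sub>E pts ?M" if "p \<in> ?T" for p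
    proof -
      have "snd p \<in> U1" using that by auto
      from induced_map_funcset[OF descends_tilted_rotation[OF this]] show ?thesis
        by (simp add: tilted_action_def toric_manifold_def)
    qed
    show "open (c ` U)" if "(U, c) \<in> atlas ?M" for U c
      using that by (auto simp: toric_manifold_def intro: quotient_atlas_open)
  qed
  moreover have "(\<lambda>p. ?\<Phi> (fst p) (snd p)) ` topspace (top_of_set ?T) \<subseteq> Ham ?M"
    by (rule image_subsetI) (rule tilted_action_Ham[OF pos], auto)
  ultimately have "continuous_map (top_of_set ?T) (Ham_topology ?M) (\<lambda>(s, u). ?\<Phi> s u)"
    unfolding Ham_topology_def continuous_map_in_subtopology by (auto simp: case_prod_beta')
  then show ?thesis
    unfolding hom_homotopic_def using hom \<phi> by (auto simp: psi_eq intro!: exI[of _ ?\<Phi>])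
qed

text \<open>After a quarter turn the action rotates coordinate \<open>n + 2\<close> by \<open>u powi b\<^sub>l\<close>. Up to the torus this is a
  rotation of coordinate \<open>n\<close> by the inverse factor, at the cost of the factors \<open>u powi (a\<^sub>j * b\<^sub>l)\<close> on the others.\<close>

lemma psi_eq_quarter_turn:
  fixes a :: "'k::finite \<Rightarrow> int"
  assumes b': "\<And>j. j \<noteq> l \<Longrightarrow> b' $ j = b $ j + a j * b $ l" "b' $ l = - b $ l" and u: "u \<in> U1"
  shows "psi a l \<sigma> \<tau> b' u = tilted_action a l \<sigma> \<tau> b (pi / 2) u"
proof (rule ext)
  fix X
  let ?Z = "level_set a l \<sigma> \<tau>" and ?R = "orbit_rel a l \<sigma> \<tau>"
  show "psi a l \<sigma> \<tau> b' u X = tilted_action a l \<sigma> \<tau> b (pi / 2) u X"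
  proof (cases "X \<in> ?Z // ?R")
    case True
    then obtain z where z: "z \<in> ?Z" "X = ?R `` {z}" by (auto elim: quotientE)
    have u0: "u \<noteq> 0" using u by auto
    let ?y = "tilted_rotation l b (pi / 2) u z"
    have y: "?y \<in> ?Z" using descends_in[OF descends_tilted_rotation[OF u] z(1)] .
    \<comment> \<open>The torus element with parameters \<open>\<mu> = 1\<close>, \<open>\<epsilon> = u powi (- b\<^sub>l)\<close> moves the rotation from
      coordinate \<open>Inr True\<close> to coordinate \<open>Inl l\<close>, with the opposite sign.\<close>
    have "(u powi b $ l) powi a j = (u powi a j) powi b $ l" for j
      by (simp add: mult.commute flip: power_int_mult)
    then have "rotate_coords b' u z = torus_act a l 1 (u powi (- b $ l)) ?y"
      using b' u0
      by (auto simp: vec_eq_iff split_sum_all rotate_coords_def torus_act_def torus_char_def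
          tilted_rotation_def rotate_plane_def power_int_minus power_int_add power_int_mult field_simps)
    moreover have "u powi (- b $ l) \<in> U1" "(1::complex) \<in> U1"
      using u by (auto simp: norm_power_int)
    ultimately have "(?y, rotate_coords b' u z) \<in> ?R" using y unfolding orbit_rel_iff by blast
    then have "?R `` {?y} = ?R `` {rotate_coords b' u z}" by (rule equiv_class_eq[OF equiv_orbit_rel])
    moreover have "tilted_rotation l b' 0 u z = rotate_coords b' u z"
      by (simp add: tilted_rotation_def rotate_plane_0)
    ultimately show ?thesis
      using induced_map_class[OF descends_tilted_rotation[OF u] z(1)]
      by (simp add: psi_eq tilted_action_def z(2))
  qed (simp add: psi_def tilted_action_def induced_map_def toric_manifold_def)
qed

theorem theorem6:
  fixes a :: "'k::finite \<Rightarrow> int" and l :: 'k and \<sigma> \<tau> :: real and b b' :: "int ^ 'k"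
  assumes "\<sigma> > 0" and "\<tau> > 0"
    and "\<And>i. i \<noteq> l \<Longrightarrow> \<tau> + of_int (a i) * \<sigma> > 0"
    and "lattice_equiv a l b b'"
  shows "hom_homotopic (toric_manifold a l \<sigma> \<tau>) (psi a l \<sigma> \<tau> b) (psi a l \<sigma> \<tau> b')"
proof -
  note pos = assms(1-3)
  have hom: "circle_hom (toric_manifold a l \<sigma> \<tau>) (psi a l \<sigma> \<tau> b')"
    unfolding psi_eq by (rule circle_hom_tilted_action[OF pos])
  from assms(4) consider "b' = b"
    | "\<And>j. j \<noteq> l \<Longrightarrow> b' $ j = b $ j + a j * b $ l" "b' $ l = - b $ l"
    unfolding lattice_equiv_def by blast
  then show ?thesis
  proof cases
    case 1
    then show ?thesis by (intro hom_homotopic_tilt[OF pos hom, where \<kappa> = 0]) (simp_all add: psi_eq)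
  next
    case 2
    then show ?thesis
      by (intro hom_homotopic_tilt[OF pos hom, where \<kappa> = "pi / 2"] psi_eq_quarter_turn) auto
  qed
qed

end
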